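(* Suppose $\rho_1$ is continuously differentiable and $u_1(s)=\rho_1'(s)/s$ is continuous, and suppose that $\theta\mapsto\mathbf V(\theta)$ is continuous. Fix $\mathbf s\in\mathbb R^k\times\mathbb R^{kq}$. Let $\sigma(P)$ be a solution of the scale equation at $P$ and let $\xi(P)=(\beta_1(P),\gamma(P))\in\mathfrak D$ be a local minimum of $R_P(\beta,\mathbf V(\gamma))$. Let $\sigma(P_{h,\mathbf s})$ be a solution of the scale equation at $P_{h,\mathbf s}$ and let $\xi(P_{h,\mathbf s})=(\beta_1(P_{h,\mathbf s}),\gamma(P_{h,\mathbf s}))\in\mathfrak D$ be a local minimum of $R_{P_{h,\mathbf s}}(\beta,\mathbf V(\gamma))$. Suppose that $(\xi(P_{h,\mathbf s}),\sigma(P_{h,\mathbf s}))\to(\xi(P),\sigma(P))$ as $h\downarrow0$. Let $$\Lambda_\beta(\xi,\sigma)=\int\Psi_\beta(\mathbf s,\xi,\sigma)\,dP(\mathbf s),\qquad \Psi_\beta(\mathbf s,\xi,\sigma)=u_1\left(\frac d\sigma\right)\mathbf X^T\mathbf V(\gamma)^{-1}(\mathbf y-\mathbf X\beta),$$ where $\xi=(\beta,\gamma)$ and $d^2=(\mathbf y-\mathbf X\beta)^T\mathbf V(\gamma)^{-1}(\mathbf y-\mathbf X\beta)$, and suppose that $\Lambda_\beta$ is continuously differentiable with a non-singular derivative $\mathbf D_\beta=\partial\Lambda_\beta/\partial\beta$ at $(\xi(P),\sigma(P))$. Moreover, suppose that $\beta_1(P)$ is a point of symmetry of $P$. Then $$\mathrm{IF}(\mathbf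 s;\beta_1,P)=-\mathbf D_\beta^{-1}\Psi_\beta(\mathbf s,\xi(P),\sigma(P)).$$
   Context: Fix positive integers $k,q,l$. A point $\mathbf s=(\mathbf y,\mathbf X)$, with $\mathbf y\in\mathbb R^k$ and $\mathbf X\in\mathbb R^{k\times q}$, is identified with a point of $\mathbb R^k\times\mathbb R^{kq}$; $P$ is a probability measure on this space. $\mathrm{PDS}(k)$ is the set of positive definite symmetric $k\times k$ matrices; $|\mathbf A|$ is the determinant. $\Theta\subset\mathbb R^l$ and $\mathbf V:\Theta\to\mathrm{PDS}(k)$ is a known injective (identifiable) map. Put $\Gamma(\theta)=\mathbf V(\theta)/|\mathbf V(\theta)|^{1/k}$ and $\mathfrak D=\{(\beta,\gamma)\in\mathbb R^q\times\Theta:\mathbf V(\gamma)\in\mathrm{PDS}(k),\ |\mathbf V(\gamma)|=1\}$. The loss functions $\rho_0,\rho_1:\mathbb R\to[0,\infty)$ satisfy, for $j=0,1$: $\rho_j$ is symmetric around zero, $\rho_j(0)=0$, continuous at zero, and for some finite $c_j>0$, $\rho_j$ is constant on $[c_j,\infty)$ and continuous and strictly increasing on $[0,c_j]$; moreover $\rho_1/\sup\rho_1\le\rho_0/\sup\rho_0$. Let $0<b_0<\sup\rho_0$. Initial functionals $Q\mapsto(\beta_0(Q),\theta_0(Q))\in\mathbb R^q\times\Theta$ are given. The scale equation at $Q$, to be solved for $\sigma=\sigma(Q)>0$, is $$\int\rho_0\left(\frac{\sqrt{(\mathbf y-\mathbf X\beta_0(Q))^T\Gamma(\theta_0(Q))^{-1}(\mathbf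 y-\mathbf X\beta_0(Q))}}{\sigma}\right)dQ(\mathbf s)=b_0,$$ and $R_Q(\beta,\mathbf C)=\int\rho_1\big(\sqrt{(\mathbf y-\mathbf X\beta)^T\mathbf C^{-1}(\mathbf y-\mathbf X\beta)}/\sigma(Q)\big)\,dQ(\mathbf s)$. Local minima of $R_Q(\beta,\mathbf V(\gamma))$ are local minima over $(\beta,\gamma)\in\mathfrak D$. For $0<h<1$, $P_{h,\mathbf s}=(1-h)P+h\delta_{\mathbf s}$ with $\delta_{\mathbf s}$ the Dirac measure at $\mathbf s$. The influence function of a functional $T$ is $\mathrm{IF}(\mathbf s;T,P)=\lim_{h\downarrow0}\{T(P_{h,\mathbf s})-T(P)\}/h$; the claim includes that this limit exists. A vector $\mathbf b\in\mathbb R^q$ is a point of symmetry of $P$ if for almost all $\mathbf X$, $P(\mathbf X\mathbf b+A\mid\mathbf X)=P(\mathbf X\mathbf b-A\mid\mathbf X)$ for all measurable $A\subset\mathbb R^k$ (conditional distribution of $\mathbf y$ given $\mathbf X$), where $\mathbf X\mathbf b\pm A=\{\mathbf X\mathbf b\pm\mathbf y:\mathbf y\in A\}$. *)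

theory Defs
  imports "HOL-Probability.Probability"
begin

text \<open>A data point is a pair \<open>(y, X)\<close> with \<open>y\<close> in \<open>real ^ 'k\<close> and the
  \<open>k \<times> q\<close> design matrix \<open>X\<close> in \<open>real ^ 'q ^ 'k\<close> (\<open>k\<close> rows, \<open>q\<close> columns).\<close>

type_synonym ('k, 'q) datum = "(real ^ 'k) \<times> (real ^ 'q ^ 'k)"

definition PDS :: "(real ^ 'k ^ 'k) set" where
  "PDS = {A. transpose A = A \<and> (\<forall>x. x \<noteq> 0 \<longrightarrow> 0 < x \<bullet> (A *v x))}"

definition Gamma_shape :: "(real ^ 'l \<Rightarrow> real ^ 'k ^ 'k) \<Rightarrow> real ^ 'l \<Rightarrow> real ^ 'k ^ 'k" where
  "Gamma_shape V \<theta> = (1 / det (V \<theta>) powr (1 / real CARD('k))) *\<^sub>R V \<theta>"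

definition param_dom :: "(real ^ 'l) set \<Rightarrow> (real ^ 'l \<Rightarrow> real ^ 'k ^ 'k)
    \<Rightarrow> ((real ^ 'q) \<times> (real ^ 'l)) set" where
  "param_dom \<Theta> V = {(\<beta>, \<gamma>). \<gamma> \<in> \<Theta> \<and> V \<gamma> \<in> PDS \<and> det (V \<gamma>) = 1}"

definition mahal :: "real ^ 'k ^ 'k \<Rightarrow> real ^ 'q \<Rightarrow> ('k, 'q) datum \<Rightarrow> real" where
  "mahal C \<beta> = (\<lambda>(y, X). sqrt ((y - X *v \<beta>) \<bullet> (matrix_inv C *v (y - X *v \<beta>))))"

definition loss_function :: "(real \<Rightarrow> real) \<Rightarrow> bool" where
  "loss_function \<rho> \<longleftrightarrow>
     (\<forall>s. 0 \<le> \<rho> s) \<and> (\<forall>s. \<rho> (- s) = \<rho> s) \<and> \<rho> 0 = 0 \<and> isCont \<rho> 0 \<and>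
     (\<exists>c>0. (\<forall>s\<ge>c. \<rho> s = \<rho> c) \<and> continuous_on {0..c} \<rho> \<and> strict_mono_on {0..c} \<rho>)"

definition scale_solution :: "(real \<Rightarrow> real) \<Rightarrow> real \<Rightarrow> (real ^ 'l \<Rightarrow> real ^ 'k ^ 'k)
    \<Rightarrow> (('k, 'q) datum measure \<Rightarrow> real ^ 'q) \<Rightarrow> (('k, 'q) datum measure \<Rightarrow> real ^ 'l)
    \<Rightarrow> ('k, 'q) datum measure \<Rightarrow> real \<Rightarrow> bool" where
  "scale_solution \<rho>0 b0 V \<beta>0 \<theta>0 Q \<sigma> \<longleftrightarrow>
     0 < \<sigma> \<and> (\<integral>s. \<rho>0 (mahal (Gamma_shape V (\<theta>0 Q)) (\<beta>0 Q) s / \<sigma>) \<partial>Q) = b0"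

definition R_obj :: "(real \<Rightarrow> real) \<Rightarrow> (('k, 'q) datum measure \<Rightarrow> real)
    \<Rightarrow> ('k, 'q) datum measure \<Rightarrow> real ^ 'q \<Rightarrow> real ^ 'k ^ 'k \<Rightarrow> real" where
  "R_obj \<rho>1 \<sigma> Q \<beta> C = (\<integral>s. \<rho>1 (mahal C \<beta> s / \<sigma> Q) \<partial>Q)"

definition local_min_on :: "'a::metric_space set \<Rightarrow> ('a \<Rightarrow> real) \<Rightarrow> 'a \<Rightarrow> bool" where
  "local_min_on S f x \<longleftrightarrow> x \<in> S \<and> (\<exists>e>0. \<forall>z\<in>S. dist z x < e \<longrightarrow> f x \<le> f z)"

definition contam :: "'a::topological_space measure \<Rightarrow> 'a \<Rightarrow> real \<Rightarrow> 'a measure" where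
  "contam P s h = measure_of UNIV (sets borel)
     (\<lambda>A. ennreal (1 - h) * emeasure P A + ennreal h * emeasure (return borel s) A)"

lemma sets_contam [simp]: "sets (contam P s h) = sets borel"
  unfolding contam_def by (metis sets.sets_measure_of_eq space_borel)

lemma space_contam [simp]: "space (contam P s h) = UNIV"
  by (simp add: contam_def)

lemma emeasure_contam:
  assumes P: "sets P = sets borel" and A: "A \<in> sets borel"
  shows "emeasure (contam P s h) A =
    ennreal (1 - h) * emeasure P A + ennreal h * emeasure (return borel s) A"
    (is "_ = ?\<mu> A")
proof (rule emeasure_measure_of[OF contam_def])
  show "countably_additive (sets (contam P s h)) ?\<mu>"
  proof (rule countably_additiveI)
    fix F :: "nat \<Rightarrow> 'a set"
    assume F: "range F \<subseteq> sets (contam P s h)" "disjoint_family F"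
    then have "(\<Sum>i. emeasure P (F i)) = emeasure P (\<Union>i. F i)"
      "(\<Sum>i. emeasure (return borel s) (F i)) = emeasure (return borel s) (\<Union>i. F i)"
      by (intro suminf_emeasure; simp add: P)+
    then show "(\<Sum>i. ?\<mu> (F i)) = ?\<mu> (\<Union>i. F i)"
      by (subst suminf_add[symmetric]) simp_all
  qed
qed (use A in \<open>auto simp: positive_def\<close>)

lemma prob_space_contam:
  assumes "prob_space P" "sets P = sets borel" "0 \<le> h" "h \<le> 1"
  shows "prob_space (contam P s h)"
proof (rule prob_spaceI)
  have sp: "space P = UNIV" using sets_eq_imp_space_eq[OF assms(2)] by simp
  have "emeasure P UNIV = 1" using prob_space.emeasure_space_1[OF assms(1)] sp by simp
  then show "emeasure (contam P s h) (space (contam P s h)) = 1"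
    using assms by (simp add: emeasure_contam flip: ennreal_plus)
qed

definition has_influence_function ::
    "('a::topological_space measure \<Rightarrow> 'b::real_normed_vector) \<Rightarrow> 'a measure \<Rightarrow> 'a \<Rightarrow> 'b \<Rightarrow> bool" where
  "has_influence_function T P s L \<longleftrightarrow>
     ((\<lambda>h. (T (contam P s h) - T P) /\<^sub>R h) \<longlongrightarrow> L) (at_right 0)"

definition cond_distr :: "('y::topological_space \<times> 'x::topological_space) measure
    \<Rightarrow> ('x \<Rightarrow> 'y measure) \<Rightarrow> bool" where
  "cond_distr P K \<longleftrightarrow> K \<in> borel \<rightarrow>\<^sub>M prob_algebra borel \<and>
     (\<forall>A\<in>sets borel. \<forall>B\<in>sets borel.
        emeasure P (A \<times> B) = (\<integral>\<^sup>+X. emeasure (K X) A * indicator B X \<partial>distr P borel snd))"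

text \<open>On Euclidean spaces a conditional distribution of \<open>y\<close> given \<open>X\<close> always exists and is
  unique up to a null set of \<open>X\<close>, so the property below does not depend on the version chosen.\<close>

definition point_of_symmetry :: "('k::finite, 'q::finite) datum measure \<Rightarrow> real ^ 'q \<Rightarrow> bool" where
  "point_of_symmetry P b \<longleftrightarrow>
     (\<exists>K. cond_distr P K \<and>
       (AE X in distr P borel snd. \<forall>A\<in>sets borel.
          measure (K X) ((\<lambda>y. X *v b + y) ` A) = measure (K X) ((\<lambda>y. X *v b - y) ` A)))"

definition Psi_beta :: "(real \<Rightarrow> real) \<Rightarrow> (real ^ 'l \<Rightarrow> real ^ 'k ^ 'k) \<Rightarrow> ('k, 'q) datum
    \<Rightarrow> (real ^ 'q) \<times> (real ^ 'l) \<Rightarrow> real \<Rightarrow> real ^ 'q" where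
  "Psi_beta u1 V = (\<lambda>(y, X) (\<beta>, \<gamma>) \<sigma>.
     u1 (mahal (V \<gamma>) \<beta> (y, X) / \<sigma>) *\<^sub>R
       (transpose X *v (matrix_inv (V \<gamma>) *v (y - X *v \<beta>))))"

definition Lambda_beta :: "(real \<Rightarrow> real) \<Rightarrow> (real ^ 'l \<Rightarrow> real ^ 'k ^ 'k)
    \<Rightarrow> ('k::finite, 'q::finite) datum measure \<Rightarrow> (real ^ 'q) \<times> (real ^ 'l) \<Rightarrow> real \<Rightarrow> real ^ 'q" where
  "Lambda_beta u1 V P \<xi> \<sigma> = (\<integral>s. Psi_beta u1 V s \<xi> \<sigma> \<partial>P)"

text \<open>Continuous differentiability near \<open>x\<close> relative to a domain \<open>S\<close> that need not be open:
  \<open>param_dom\<close> has, in general, empty interior because of the constraint on the determinant.\<close>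

definition C1_near_within :: "('a::real_normed_vector \<Rightarrow> 'b::real_normed_vector) \<Rightarrow> 'a \<Rightarrow> 'a set \<Rightarrow> bool" where
  "C1_near_within f x S \<longleftrightarrow>
     (\<exists>U f'. open U \<and> x \<in> U \<and>
        (\<forall>z\<in>U \<inter> S. (f has_derivative blinfun_apply (f' z)) (at z within S)) \<and>
        continuous_on (U \<inter> S) f')"

end

theory Submission
  imports Defs
begin

text \<open>The first-order condition for the minimum \<open>\<beta>\<^sub>1(P\<^sub>h)\<close> is an estimating equation, and the symmetry
  of \<open>P\<close> removes the influence of \<open>\<gamma>\<close> and \<open>\<sigma>\<close> on its solution. Write \<open>(\<beta>, \<gamma>, \<sigma>)\<close> for the
  limit values at \<open>P\<close>, \<open>(\<beta>\<^sub>h, \<gamma>\<^sub>h, \<sigma>\<^sub>h)\<close> for the values at the contaminated measure \<open>P\<^sub>h\<close>, and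
  \<open>\<Lambda>\<close>, \<open>\<Psi>\<close> for \<^const>\<open>Lambda_beta\<close>, \<^const>\<open>Psi_beta\<close>.

  Since the constraint on the parameter restricts only \<open>\<gamma>\<close>, \<open>\<beta>\<^sub>h\<close> is an unconstrained local minimum
  of the contaminated risk with \<open>\<gamma>\<^sub>h\<close> and \<open>\<sigma>\<^sub>h\<close> held fixed. The contaminated risk is
  \<open>(1 - h)\<close> times the risk at \<open>P\<close> plus \<open>h\<close> times the loss at \<open>s\<close>, and the gradient in \<open>\<beta>\<close> of the
  loss is \<open>- \<Psi> / \<sigma>\<^sup>2\<close>, so stationarity reads
  \<open>(1 - h) \<Lambda>(\<beta>\<^sub>h, \<gamma>\<^sub>h, \<sigma>\<^sub>h) + h \<Psi>(s, \<beta>\<^sub>h, \<gamma>\<^sub>h, \<sigma>\<^sub>h) = 0\<close> (lemma \<open>contaminated_risk_stationary\<close>).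

  Differentiating the risk under the integral is the delicate point: \<open>\<Psi>\<close> grows with the design
  matrix \<open>X\<close>, which may have no finite moment, so a dominating function need not exist. Along a line
  \<open>\<beta> + \<tau> v\<close>, however, the Mahalanobis distance first decreases and then increases, and so does
  the loss, which takes values in \<open>[0, M]\<close>. Its total variation along the line is therefore at most
  \<open>2 M\<close>, uniformly in the data point. This makes the derivative jointly integrable over data
  and \<open>\<tau>\<close>; Fubini turns an increment of the risk into an integral of \<open>v \<bullet> \<Lambda>\<close>, and continuity of
  \<open>\<Lambda>\<close> gives the derivative (lemmas \<open>unimodal_integral_has_derivative\<close> and
  \<open>risk_has_directional_derivative\<close>).

  If \<open>\<beta>\<close> is a point of symmetry, \<open>P\<close> is invariant under reflecting \<open>y\<close> at \<open>X \<beta>\<close>, under which \<open>\<Psi>\<close>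
  changes sign. So \<open>\<Lambda>(\<beta>, \<gamma>\<^sub>h, \<sigma>\<^sub>h) = 0\<close> for every \<open>h\<close> (lemma
  \<open>Lambda_beta_point_of_symmetry\<close>). Continuous differentiability of \<open>\<Lambda>\<close> and the mean value
  inequality in the \<open>\<beta>\<close> direction alone then give
  \<open>\<Lambda>(\<beta>\<^sub>h, \<gamma>\<^sub>h, \<sigma>\<^sub>h) = D (\<beta>\<^sub>h - \<beta>) + o(\<beta>\<^sub>h - \<beta>)\<close> (lemma \<open>C1_near_within_slice\<close>).
  Dividing by \<open>h\<close>, the quotient \<open>(\<beta>\<^sub>h - \<beta>) / h\<close> solves
  a vanishing perturbation of the linear equation with matrix \<open>D\<close> and right-hand side tending to
  \<open>- \<Psi>(s, \<beta>, \<gamma>, \<sigma>)\<close> (lemma \<open>perturbed_linear_equation_tendsto\<close>).\<close>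

section \<open>Differentiating the integral of a family of unimodal functions\<close>

lemma integral_indicator_FTC:
  fixes F f :: "real \<Rightarrow> real"
  assumes deriv: "\<And>x. (F has_real_derivative f x) (at x)" and cont: "continuous_on UNIV f"
  shows "integrable lborel (\<lambda>x. indicator {a..b} x * f x)"
    and "a \<le> b \<Longrightarrow> (\<integral>x. indicator {a..b} x * f x \<partial>lborel) = F b - F a"
  using borel_integrable_compact[of "{a..b}" f] integral_FTC_atLeastAtMost[of a b F f] deriv
    continuous_on_subset[OF cont]
  by (simp_all add: indicator_scaleR_eq_if if_distrib if_distribR indicator_def
      has_real_derivative_iff_has_vector_derivative has_vector_derivative_at_within cong: if_cong)

text \<open>The integral of \<open>\<bar>F'\<bar>\<close> is the total variation of \<open>F\<close>: a drop and a rise, each at most \<open>M\<close>.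
  The bound depends neither on the interval nor on the slope of \<open>F\<close>, and this uniformity replaces
  a dominating function below.\<close>

lemma unimodal_abs_integral_le:
  fixes F f :: "real \<Rightarrow> real"
  assumes deriv: "\<And>x. (F has_real_derivative f x) (at x)"
    and cont: "continuous_on UNIV f"
    and sign: "\<And>x. x \<le> m \<Longrightarrow> f x \<le> 0" "\<And>x. m \<le> x \<Longrightarrow> 0 \<le> f x"
    and bound: "\<And>x. 0 \<le> F x" "\<And>x. F x \<le> M"
    and ab: "a \<le> b"
  shows "(\<integral>x. \<bar>indicator {a..b} x * f x\<bar> \<partial>lborel) \<le> 2 * M"
proof -
  \<comment> \<open>The turning point may lie outside the interval; \<open>c\<close> is its projection onto it.\<close>
  define c where "c = max a (min b m)"
  have c: "a \<le> c" "c \<le> b" using ab by (auto simp: c_def)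
  note int = integral_indicator_FTC(1)[OF deriv cont] and FTC = integral_indicator_FTC(2)[OF deriv cont]
  have "(\<integral>x. \<bar>indicator {a..b} x * f x\<bar> \<partial>lborel) \<le>
      (\<integral>x. indicator {c..b} x * f x - indicator {a..c} x * f x \<partial>lborel)"
  proof (rule integral_mono_AE)
    show "integrable lborel (\<lambda>x. \<bar>indicator {a..b} x * f x\<bar>)"
      using int by (rule integrable_abs)
    show "integrable lborel (\<lambda>x. indicator {c..b} x * f x - indicator {a..c} x * f x)"
      using int by simp
    \<comment> \<open>The point \<open>c\<close> lies in both intervals, and there the two terms on the right cancel.\<close>
    show "AE x in lborel. \<bar>indicator {a..b} x * f x\<bar> \<le>
        indicator {c..b} x * f x - indicator {a..c} x * f x"
      using AE_lborel_singleton[of c]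
    proof eventually_elim
      fix x assume "x \<noteq> c"
      then show "\<bar>indicator {a..b} x * f x\<bar> \<le>
          indicator {c..b} x * f x - indicator {a..c} x * f x"
        using sign[of x] by (auto simp: indicator_def c_def min_def max_def split: if_splits)
    qed
  qed
  also have "\<dots> = (F b - F c) - (F c - F a)"
    using int FTC c by simp
  also have "\<dots> \<le> 2 * M"
    using bound(1)[of c] bound(2)[of a] bound(2)[of b] by simp
  finally show ?thesis .
qed

text \<open>The fundamental theorem of calculus for each \<open>z\<close>, integrated over \<open>z\<close>. Fubini applies because
  the inner integrals of \<open>\<bar>f z\<bar>\<close> are at most \<open>2 M\<close> and \<open>P\<close> is finite.\<close>

lemma unimodal_integral_FTC:
  fixes F f :: "'a \<Rightarrow> real \<Rightarrow> real"
  assumes P: "prob_space P"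
    and meas [measurable]: "case_prod f \<in> borel_measurable (P \<Otimes>\<^sub>M borel)"
    and measF [measurable]: "\<And>x. (\<lambda>z. F z x) \<in> borel_measurable P"
    and deriv: "\<And>z x. (F z has_real_derivative f z x) (at x)"
    and cont: "\<And>z. continuous_on UNIV (f z)"
    and sign: "\<And>z. \<exists>m. (\<forall>x\<le>m. f z x \<le> 0) \<and> (\<forall>x\<ge>m. 0 \<le> f z x)"
    and bound: "\<And>z x. 0 \<le> F z x" "\<And>z x. F z x \<le> M"
    and ab: "a \<le> b"
  shows "(\<integral>z. F z b \<partial>P) - (\<integral>z. F z a \<partial>P) =
    (\<integral>x. indicator {a..b} x * (\<integral>z. f z x \<partial>P) \<partial>lborel)"
proof -
  interpret prob_space P by fact
  interpret PL: pair_sigma_finite P lborel ..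
  have intF: "integrable P (\<lambda>z. F z x)" for x
    by (rule integrable_const_bound[where B = M]) (use bound in auto)
  note int = integral_indicator_FTC(1)[OF deriv cont] and FTC = integral_indicator_FTC(2)[OF deriv cont ab]
  have meas2 [measurable]: "case_prod f \<in> borel_measurable (P \<Otimes>\<^sub>M lborel)"
    using meas by (simp cong: measurable_cong_sets)
  have "integrable (P \<Otimes>\<^sub>M lborel) (\<lambda>(z, x). indicator {a..b} x * f z x)"
  proof (rule PL.Fubini_integrable)
    show "(\<lambda>(z, x). indicator {a..b} x * f z x) \<in> borel_measurable (P \<Otimes>\<^sub>M lborel)"
      by measurable
    have nn: "0 \<le> (\<integral>x. \<bar>indicator {a..b} x * f z x\<bar> \<partial>lborel)" for z
      by (rule Bochner_Integration.integral_nonneg) simp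
    have le: "(\<integral>x. \<bar>indicator {a..b} x * f z x\<bar> \<partial>lborel) \<le> 2 * M" for z
    proof -
      obtain m where "\<forall>x\<le>m. f z x \<le> 0" "\<forall>x\<ge>m. 0 \<le> f z x" using sign by blast
      then show ?thesis
        by (intro unimodal_abs_integral_le[where F = "F z" and m = m])
           (use deriv cont bound ab in auto)
    qed
    have "integrable P (\<lambda>z. \<integral>x. \<bar>indicator {a..b} x * f z x\<bar> \<partial>lborel)"
    proof (rule integrable_const_bound[where B = "2 * M"])
      show "AE z in P. norm (\<integral>x. \<bar>indicator {a..b} x * f z x\<bar> \<partial>lborel) \<le> 2 * M"
        using le nn by simp
      show "(\<lambda>z. \<integral>x. \<bar>indicator {a..b} x * f z x\<bar> \<partial>lborel) \<in> borel_measurable P"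
        by measurable
    qed
    then show "integrable P (\<lambda>z. \<integral>x. norm (case (z, x) of (z, x) \<Rightarrow> indicator {a..b} x * f z x) \<partial>lborel)"
      by simp
    show "AE z in P. integrable lborel (\<lambda>x. case (z, x) of (z, x) \<Rightarrow> indicator {a..b} x * f z x)"
      using int by simp
  qed
  from PL.Fubini_integral[OF this]
  have "(\<integral>x. (\<integral>z. indicator {a..b} x * f z x \<partial>P) \<partial>lborel) =
      (\<integral>z. (\<integral>x. indicator {a..b} x * f z x \<partial>lborel) \<partial>P)" .
  also have "\<dots> = (\<integral>z. F z b - F z a \<partial>P)" by (simp only: FTC)
  also have "\<dots> = (\<integral>z. F z b \<partial>P) - (\<integral>z. F z a \<partial>P)"
    using intF by simp
  finally show ?thesis by simp
qed

text \<open>Continuity of the averaged derivative is enough to differentiate under the integral: by the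
  preceding lemma the averaged function differs from an antiderivative of it by a constant.\<close>

lemma unimodal_integral_has_derivative:
  fixes F f :: "'a \<Rightarrow> real \<Rightarrow> real"
  assumes P: "prob_space P"
    and meas: "case_prod f \<in> borel_measurable (P \<Otimes>\<^sub>M borel)"
    and measF: "\<And>x. (\<lambda>z. F z x) \<in> borel_measurable P"
    and deriv: "\<And>z x. (F z has_real_derivative f z x) (at x)"
    and cont: "\<And>z. continuous_on UNIV (f z)"
    and sign: "\<And>z. \<exists>m. (\<forall>x\<le>m. f z x \<le> 0) \<and> (\<forall>x\<ge>m. 0 \<le> f z x)"
    and bound: "\<And>z x. 0 \<le> F z x" "\<And>z x. F z x \<le> M"
    and r: "0 < r"
    and cont_int: "continuous_on {-r..r} (\<lambda>x. \<integral>z. f z x \<partial>P)"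
  shows "((\<lambda>x. \<integral>z. F z x \<partial>P) has_real_derivative (\<integral>z. f z 0 \<partial>P)) (at 0)"
proof -
  define g where "g = (\<lambda>x. \<integral>z. f z x \<partial>P)"
  obtain H where H: "\<And>x. x \<in> {-r..r} \<Longrightarrow> (H has_vector_derivative g x) (at x within {-r..r})"
    using antiderivative_continuous[OF cont_int[folded g_def]] by blast
  have eq: "(\<integral>z. F z x \<partial>P) = H x + ((\<integral>z. F z (-r) \<partial>P) - H (-r))" if x: "x \<in> {-r..r}" for x
  proof -
    have "(\<integral>z. F z x \<partial>P) - (\<integral>z. F z (-r) \<partial>P) = (\<integral>x'. indicator {-r..x} x' * g x' \<partial>lborel)"
      unfolding g_def
      by (rule unimodal_integral_FTC[where M = M]) (use assms x in auto)
    also have "\<dots> = H x - H (-r)"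
      using integral_FTC_atLeastAtMost[of "-r" x H g] x
        continuous_on_subset[OF cont_int[folded g_def], of "{-r..x}"]
        has_vector_derivative_within_subset[OF H, of _ "{-r..x}"]
      by auto
    finally show ?thesis by simp
  qed
  have "(H has_real_derivative g 0) (at 0)"
    using H[of 0] r at_within_Icc_at[of "-r" 0 r]
    by (simp add: has_real_derivative_iff_has_vector_derivative)
  then have "((\<lambda>x. H x + ((\<integral>z. F z (-r) \<partial>P) - H (-r))) has_real_derivative g 0) (at 0)"
    by (auto intro!: derivative_eq_intros)
  moreover have "\<forall>\<^sub>F x in nhds 0. x \<in> {-r<..<r}"
    using r by (intro eventually_nhds_in_open) auto
  then have "\<forall>\<^sub>F x in nhds 0. (\<integral>z. F z x \<partial>P) = H x + ((\<integral>z. F z (-r) \<partial>P) - H (-r))"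
    by eventually_elim (rule eq, auto)
  ultimately show ?thesis
    unfolding g_def by (subst DERIV_cong_ev[OF refl _ refl]) auto
qed

section \<open>Integrals with respect to a contaminated measure\<close>

lemma integral_contam:
  fixes f :: "'a::topological_space \<Rightarrow> real"
  assumes P: "prob_space P" "sets P = sets borel" and h: "0 \<le> h" "h \<le> 1"
    and f [measurable]: "f \<in> borel_measurable borel" and bound: "\<And>z. 0 \<le> f z" "\<And>z. f z \<le> M"
  shows "(\<integral>z. f z \<partial>contam P s h) = (1 - h) * (\<integral>z. f z \<partial>P) + h * f s"
proof -
  interpret prob_space P by fact
  define K where "K = (\<lambda>c. if c then return borel s else P)"
  have K: "K \<in> measurable (measure_pmf (bernoulli_pmf h)) (subprob_algebra borel)"
    using P by (auto simp: K_def space_subprob_algebra prob_space_return prob_space_imp_subprob_space)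
  have fP [measurable]: "f \<in> borel_measurable P"
    using f P(2) by (simp cong: measurable_cong_sets)
  \<comment> \<open>A draw from the contaminated measure: a coin with bias \<open>h\<close> decides between \<open>s\<close> and \<open>P\<close>.\<close>
  have "contam P s h = measure_pmf (bernoulli_pmf h) \<bind> K"
  proof (rule measure_eqI)
    show "sets (contam P s h) = sets (measure_pmf (bernoulli_pmf h) \<bind> K)"
      using sets_bind[of "measure_pmf (bernoulli_pmf h)" K borel] P(2) by (simp add: K_def)
    fix A assume "A \<in> sets (contam P s h)"
    then have A: "A \<in> sets borel" by simp
    show "emeasure (contam P s h) A = emeasure (measure_pmf (bernoulli_pmf h) \<bind> K) A"
      by (subst emeasure_bind[OF _ K A])
         (use A P h in \<open>simp_all add: emeasure_contam K_def mult.commute add.commute\<close>)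
  qed
  then have nn: "(\<integral>\<^sup>+z. ennreal (f z) \<partial>contam P s h) =
      ennreal h * ennreal (f s) + ennreal (1 - h) * (\<integral>\<^sup>+z. ennreal (f z) \<partial>P)"
    using h by (simp only: nn_integral_bind[OF _ K] measurable_compose[OF f measurable_ennreal])
      (simp add: K_def nn_integral_return mult.commute)
  have int: "integrable P f"
    by (rule integrable_const_bound[where B = M]) (use bound in auto)
  have "(\<integral>z. f z \<partial>contam P s h) = enn2real (\<integral>\<^sup>+z. ennreal (f z) \<partial>contam P s h)"
    by (rule integral_eq_nn_integral) (use bound in \<open>auto cong: measurable_cong_sets\<close>)
  also have "(\<integral>\<^sup>+z. ennreal (f z) \<partial>contam P s h) = ennreal (h * f s + (1 - h) * (\<integral>z. f z \<partial>P))"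
    unfolding nn using nn_integral_eq_integral[OF int] bound h
    by (simp add: ennreal_mult ennreal_plus integral_nonneg)
  finally show ?thesis
    using bound h by (simp add: integral_nonneg del: ennreal_plus)
qed

section \<open>Positive definite matrices and the score function\<close>

lemma PDS_inner_commute:
  assumes "W \<in> PDS"
  shows "x \<bullet> (W *v y) = y \<bullet> (W *v x)"
proof -
  have "x \<bullet> (W *v y) = (transpose W *v x) \<bullet> y"
    by (simp add: transpose_matrix_vector dot_lmul_matrix)
  then show ?thesis using assms by (simp add: PDS_def inner_commute del: transpose_matrix_vector)
qed

lemma PDS_inner_nonneg: "W \<in> PDS \<Longrightarrow> 0 \<le> x \<bullet> (W *v x)"
  by (cases "x = 0") (auto simp: PDS_def less_imp_le)

lemma PDS_inner_pos: "W \<in> PDS \<Longrightarrow> x \<noteq> 0 \<Longrightarrow> 0 < x \<bullet> (W *v x)"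
  by (simp add: PDS_def)

lemma PDS_invertible:
  assumes "A \<in> PDS"
  shows "invertible A"
proof -
  have "x = 0" if "A *v x = 0" for x
    using PDS_inner_pos[OF assms, of x] that by auto
  then show ?thesis
    by (simp add: invertible_left_inverse matrix_left_invertible_ker)
qed

lemma matrix_inv_invertible:
  fixes A :: "real ^ 'n ^ 'n"
  assumes "invertible A"
  shows "A ** matrix_inv A = mat 1" "matrix_inv A ** A = mat 1"
  using someI_ex[OF assms[unfolded invertible_def]] by (auto simp: matrix_inv_def)

lemma PDS_matrix_inv:
  assumes "A \<in> PDS"
  shows "matrix_inv A \<in> PDS"
proof -
  let ?B = "matrix_inv A"
  note inv = matrix_inv_invertible[OF PDS_invertible[OF assms]]
  have sym: "transpose A = A" using assms by (simp add: PDS_def)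
  have "transpose ?B ** A = mat 1"
    using arg_cong[OF inv(1), of transpose] sym by (simp add: matrix_transpose_mul)
  then have "transpose ?B ** (A ** ?B) = ?B"
    by (simp add: matrix_mul_assoc)
  then have "transpose ?B = ?B" by (simp add: inv)
  moreover have "0 < x \<bullet> (?B *v x)" if "x \<noteq> 0" for x
  proof -
    have x: "A *v (?B *v x) = x" by (simp add: matrix_vector_mul_assoc inv)
    then have "?B *v x \<noteq> 0" using that by auto
    from PDS_inner_pos[OF assms this] x show ?thesis by (simp add: inner_commute)
  qed
  ultimately show ?thesis by (simp add: PDS_def)
qed

lemma continuous_on_matrix_vector_mult [continuous_intros]:
  fixes A :: "'a::topological_space \<Rightarrow> real ^ 'n ^ 'm"
  assumes "continuous_on S A" "continuous_on S x"
  shows "continuous_on S (\<lambda>s. A s *v x s)"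
  unfolding matrix_vector_mult_def
  by (intro continuous_on_vec_lambda continuous_on_sum continuous_on_mult continuous_on_component assms)

lemma continuous_on_transpose_comp [continuous_intros]:
  fixes A :: "'a::topological_space \<Rightarrow> real ^ 'n ^ 'm"
  assumes "continuous_on S A"
  shows "continuous_on S (\<lambda>s. transpose (A s))"
  unfolding transpose_def
  by (intro continuous_on_vec_lambda continuous_on_component assms)

lemma tendsto_det:
  fixes A :: "'a \<Rightarrow> real ^ 'n ^ 'n"
  assumes "(A \<longlongrightarrow> L) F"
  shows "((\<lambda>a. det (A a)) \<longlongrightarrow> det L) F"
  unfolding det_def by (intro tendsto_intros tendsto_vec_nth assms)

text \<open>Cramer's rule writes \<open>A\<^sup>-\<^sup>1 x\<close> as a quotient of determinants, which are continuous in \<open>A\<close> and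
  \<open>x\<close>.\<close>

lemma tendsto_matrix_inv_vector_mult:
  fixes A :: "'a \<Rightarrow> real ^ 'n ^ 'n"
  assumes A: "(A \<longlongrightarrow> L) F" and x: "(x \<longlongrightarrow> y) F"
    and inv: "\<forall>\<^sub>F a in F. invertible (A a)" "invertible L"
  shows "((\<lambda>a. matrix_inv (A a) *v x a) \<longlongrightarrow> matrix_inv L *v y) F"
proof -
  have Cramer: "matrix_inv B *v z = (\<chi> k. det (\<chi> i j. if j = k then z $ i else B $ i $ j) / det B)"
    if "invertible B" for B :: "real ^ 'n ^ 'n" and z
  proof -
    have "B *v (matrix_inv B *v z) = z"
      by (simp add: matrix_vector_mul_assoc matrix_inv_invertible[OF that])
    then show ?thesis using cramer[of B "matrix_inv B *v z" z] that by (simp add: invertible_det_nz)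
  qed
  have "((\<lambda>a. \<chi> k. det (\<chi> i j. if j = k then x a $ i else A a $ i $ j) / det (A a))
      \<longlongrightarrow> (\<chi> k. det (\<chi> i j. if j = k then y $ i else L $ i $ j) / det L)) F"
  proof (intro tendsto_vec_lambda tendsto_divide tendsto_det)
    show "((\<lambda>a. if j = k then x a $ i else A a $ i $ j) \<longlongrightarrow> (if j = k then y $ i else L $ i $ j)) F"
      for i j k
      by (cases "j = k") (simp_all add: tendsto_vec_nth A x)
  qed (use A inv in \<open>auto simp: invertible_det_nz\<close>)
  then show ?thesis
    unfolding Cramer[OF inv(2)]
    by (rule Lim_transform_eventually) (use inv(1) in eventually_elim, simp add: Cramer)
qed

text \<open>Moving \<open>X\<^sup>T\<close> to the other side of the inner product gives the form in which \<open>\<Psi>\<close> appears as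
  a derivative along the direction \<open>v\<close>.\<close>

lemma Psi_beta_inner:
  "v \<bullet> Psi_beta u V (y, X) (b, g) t =
    u (mahal (V g) b (y, X) / t) * ((X *v v) \<bullet> (matrix_inv (V g) *v (y - X *v b)))"
  by (simp add: Psi_beta_def transpose_matrix_vector dot_lmul_matrix inner_commute[of v]
      flip: inner_commute[of _ "X *v v"])

lemma continuous_on_mahal [continuous_intros]:
  assumes "continuous_on S b" "continuous_on S z"
  shows "continuous_on S (\<lambda>s. mahal C (b s) (z s))"
  unfolding mahal_def case_prod_beta
  by (intro continuous_intros continuous_on_matrix_vector_mult assms)

lemma continuous_on_Psi_beta:
  assumes "continuous_on UNIV u" "t \<noteq> 0" "continuous_on S b" "continuous_on S z"
  shows "continuous_on S (\<lambda>s. Psi_beta u V (z s) (b s, g) t)"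
  unfolding Psi_beta_def case_prod_beta prod.collapse fst_conv snd_conv
  by (intro continuous_intros continuous_on_matrix_vector_mult assms
      continuous_on_compose2[OF assms(1)]) (use assms in auto)

lemma tendsto_Psi_beta:
  assumes u: "isCont u (mahal (V g0) b0 (y, X) / t0)" and t: "t0 \<noteq> 0" "(t \<longlongrightarrow> t0) F" and b: "(b \<longlongrightarrow> b0) F"
    and V: "((\<lambda>a. V (g a)) \<longlongrightarrow> V g0) F" "\<forall>\<^sub>F a in F. invertible (V (g a))" "invertible (V g0)"
  shows "((\<lambda>a. Psi_beta u V (y, X) (b a, g a) (t a)) \<longlongrightarrow> Psi_beta u V (y, X) (b0, g0) t0) F"
proof -
  have lin: "((\<lambda>a. A *v x a) \<longlongrightarrow> A *v x0) F" if "(x \<longlongrightarrow> x0) F"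
    for A :: "real ^ 'm ^ 'n" and x x0
    using isCont_tendsto_compose[OF matrix_vector_mult_linear_continuous_at that] .
  have r: "((\<lambda>a. y - X *v b a) \<longlongrightarrow> y - X *v b0) F"
    by (intro tendsto_intros lin b)
  note W = tendsto_matrix_inv_vector_mult[OF V(1) r V(2,3)]
  show ?thesis
    unfolding Psi_beta_def prod.case
    by (intro tendsto_scaleR lin W isCont_tendsto_compose[OF u])
      (use t in \<open>auto simp: mahal_def intro!: tendsto_intros r W\<close>)
qed

section \<open>The risk and its stationary points\<close>

lemma loss_function_mono:
  assumes "loss_function \<rho>" "0 \<le> x" "x \<le> y"
  shows "\<rho> x \<le> \<rho> y"
proof -
  obtain c where c: "c > 0" "\<And>s. s \<ge> c \<Longrightarrow> \<rho> s = \<rho> c" "strict_mono_on {0..c} \<rho>"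
    using assms(1) unfolding loss_function_def by blast
  have *: "\<rho> (min s c) = \<rho> s" for s using c(2)[of s] by (cases "s \<le> c") auto
  have "\<rho> (min x c) \<le> \<rho> (min y c)"
    using strict_mono_on_leD[OF c(3), of "min x c" "min y c"] assms c(1) by auto
  then show ?thesis by (simp add: *)
qed

lemma loss_function_bounded:
  assumes "loss_function \<rho>"
  shows "\<exists>M. \<forall>x. \<rho> x \<le> M"
proof -
  obtain c where c: "c > 0" "\<And>s. s \<ge> c \<Longrightarrow> \<rho> s = \<rho> c"
    using assms(1) unfolding loss_function_def by blast
  have "\<rho> x \<le> \<rho> c" for x
  proof -
    have "\<rho> x = \<rho> \<bar>x\<bar>" using assms by (auto simp: loss_function_def abs_if)
    also have "\<dots> \<le> \<rho> (max c \<bar>x\<bar>)" by (rule loss_function_mono[OF assms]) auto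
    also have "\<dots> = \<rho> c" by (rule c(2)) simp
    finally show ?thesis .
  qed
  then show ?thesis by blast
qed

lemma loss_function_deriv_nonneg:
  assumes "loss_function \<rho>" "(\<rho> has_real_derivative d) (at x)" "0 < x"
  shows "0 \<le> d"
proof (rule ccontr)
  assume "\<not> 0 \<le> d"
  then obtain e where e: "e > 0" "\<And>h. h > 0 \<Longrightarrow> h < e \<Longrightarrow> \<rho> (x + h) < \<rho> x"
    using DERIV_neg_dec_right[OF assms(2)] by auto
  have "\<rho> (x + e / 2) < \<rho> x" by (rule e(2)) (use e(1) in auto)
  then show False
    using e(1) loss_function_mono[OF assms(1), of x "x + e / 2"] assms(3) by auto
qed

text \<open>What the argument needs of a loss function \<open>\<rho>\<close> with derivative \<open>\<rho>'\<close> and weight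
  \<open>u s = \<rho>' s / s\<close>. That the loss increases away from zero enters through the sign of \<open>u\<close>.\<close>

locale smooth_loss =
  fixes \<rho> \<rho>' u :: "real \<Rightarrow> real" and M :: real
  assumes even: "\<rho> (- x) = \<rho> x"
    and nonneg: "0 \<le> \<rho> x" and bounded: "\<rho> x \<le> M"
    and deriv: "(\<rho> has_real_derivative \<rho>' x) (at x)"
    and weight: "x \<noteq> 0 \<Longrightarrow> u x = \<rho>' x / x"
    and weight_nonneg: "0 < x \<Longrightarrow> 0 \<le> u x"
    and weight_continuous: "continuous_on UNIV u"
begin

lemma deriv_zero: "\<rho>' 0 = 0"
proof -
  have "((\<lambda>x. \<rho> (- x)) has_real_derivative - \<rho>' 0) (at 0)"
    using deriv[of 0] DERIV_mirror[where f = \<rho> and x = 0 and y = "\<rho>' 0"] by simp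
  then have "(\<rho> has_real_derivative - \<rho>' 0) (at 0)" by (simp only: even)
  from DERIV_unique[OF this deriv[of 0]] show ?thesis by simp
qed

lemma loss_abs: "\<rho> \<bar>x\<bar> = \<rho> x"
  by (simp add: abs_if even)

lemma loss_continuous: "continuous_on UNIV \<rho>"
  using deriv by (meson DERIV_isCont continuous_at_imp_continuous_on)

text \<open>Where the residual is non-zero this is the chain rule for a square root of a positive
  quadratic. At a vanishing residual the square root has a kink, but the distance is then
  proportional to \<open>\<bar>x - \<tau>\<bar>\<close>, and evenness of \<open>\<rho>\<close> absorbs the absolute value.\<close>

lemma mahal_shift_has_derivative:
  fixes v :: "real ^ 'q"
  assumes C: "C \<in> PDS" and t: "t > 0"
  shows "((\<lambda>\<tau>. \<rho> (mahal C (b + \<tau> *\<^sub>R v) (y, X) / t)) has_real_derivative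
    - u (mahal C (b + x *\<^sub>R v) (y, X) / t) *
      ((X *v v) \<bullet> (matrix_inv C *v (y - X *v (b + x *\<^sub>R v)))) / t\<^sup>2) (at x)"
proof -
  let ?W = "matrix_inv C"
  define w where "w = X *v v"
  define r where "r = (\<lambda>\<tau>. y - X *v b - \<tau> *\<^sub>R w)"
  define q where "q = (\<lambda>\<tau>. r \<tau> \<bullet> (?W *v r \<tau>))"
  have W: "?W \<in> PDS" by (rule PDS_matrix_inv[OF C])
  have r: "y - X *v (b + \<tau> *\<^sub>R v) = r \<tau>" for \<tau>
    by (simp add: r_def w_def matrix_vector_right_distrib scaleR_matrix_vector_assoc[symmetric]
        matrix_vector_mult_scaleR algebra_simps)
  have m: "mahal C (b + \<tau> *\<^sub>R v) (y, X) = sqrt (q \<tau>)" for \<tau>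
    by (simp add: mahal_def r q_def)
  have "((\<lambda>\<tau>. \<rho> (sqrt (q \<tau>) / t)) has_real_derivative
      - u (sqrt (q x) / t) * (w \<bullet> (?W *v r x)) / t\<^sup>2) (at x)"
  proof (cases "r x = 0")
    case False
    then have pos: "0 < q x" unfolding q_def by (rule PDS_inner_pos[OF W])
    have q_expand: "q \<tau> = q x - 2 * (\<tau> - x) * (w \<bullet> (?W *v r x)) + (\<tau> - x)\<^sup>2 * (w \<bullet> (?W *v w))" for \<tau>
    proof -
      have shift: "r \<tau> = r x - (\<tau> - x) *\<^sub>R w" by (simp add: r_def algebra_simps)
      show ?thesis
        unfolding q_def shift
        by (simp add: PDS_inner_commute[OF W, of "r x" w] matrix_vector_mult_diff_distrib
            matrix_vector_mult_scaleR inner_diff_left inner_diff_right power2_eq_square)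
          (simp add: algebra_simps)
    qed
    have dq: "(q has_real_derivative - 2 * (w \<bullet> (?W *v r x))) (at x)"
      by (subst ext[of q, OF q_expand]) (auto intro!: derivative_eq_intros)
    have "((\<lambda>\<tau>. sqrt (q \<tau>) / t) has_real_derivative
        inverse (sqrt (q x)) / 2 * (- 2 * (w \<bullet> (?W *v r x))) / t) (at x)"
      by (intro DERIV_cdivide DERIV_chain2[OF DERIV_real_sqrt[OF pos] dq])
    from DERIV_chain2[OF deriv this] show ?thesis
      by (rule DERIV_cong) (use pos t in \<open>simp add: weight field_simps power2_eq_square\<close>)
  next
    case True
    have r': "r \<tau> = (x - \<tau>) *\<^sub>R w" for \<tau>
      using True by (simp add: r_def algebra_simps)
    have "\<rho> (sqrt (q \<tau>) / t) = \<rho> ((x - \<tau>) * (sqrt (w \<bullet> (?W *v w)) / t))" for \<tau>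
    proof -
      have "sqrt (q \<tau>) / t = \<bar>(x - \<tau>) * (sqrt (w \<bullet> (?W *v w)) / t)\<bar>"
        using t PDS_inner_nonneg[OF W, of w]
        by (simp add: q_def r' matrix_vector_mult_scaleR real_sqrt_mult abs_mult mult.assoc[symmetric])
      then show ?thesis by (simp only: loss_abs)
    qed
    moreover have "((\<lambda>\<tau>. \<rho> ((x - \<tau>) * (sqrt (w \<bullet> (?W *v w)) / t))) has_real_derivative
        \<rho>' ((x - x) * (sqrt (w \<bullet> (?W *v w)) / t)) * (- (sqrt (w \<bullet> (?W *v w)) / t))) (at x)"
      by (rule DERIV_chain2[OF deriv]) (use t in \<open>auto intro!: derivative_eq_intros\<close>)
    ultimately show ?thesis using True by (simp add: deriv_zero)
  qed
  then show ?thesis by (simp only: m r w_def)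
qed

text \<open>The factor \<open>(X v) \<bullet> (C\<^sup>-\<^sup>1 (y - X (b + x v)))\<close> is affine in \<open>x\<close> with slope at most zero, so it
  changes sign at most once, at the point of the line closest to \<open>y\<close>; the weight is nonnegative
  wherever the residual does not vanish.\<close>

lemma mahal_shift_unimodal:
  fixes b v :: "real ^ 'q" and y :: "real ^ 'k" and X :: "real ^ 'q ^ 'k"
  assumes C: "C \<in> PDS" and t: "t > 0"
  defines "f \<equiv> \<lambda>x. - u (mahal C (b + x *\<^sub>R v) (y, X) / t) *
      ((X *v v) \<bullet> (matrix_inv C *v (y - X *v (b + x *\<^sub>R v)))) / t\<^sup>2"
  shows "\<exists>m. (\<forall>x\<le>m. f x \<le> 0) \<and> (\<forall>x\<ge>m. 0 \<le> f x)"
proof -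
  let ?W = "matrix_inv C"
  have W: "?W \<in> PDS" by (rule PDS_matrix_inv[OF C])
  define w where "w = X *v v"
  define B where "B = (\<lambda>x. w \<bullet> (?W *v (y - X *v (b + x *\<^sub>R v))))"
  have B: "B x = w \<bullet> (?W *v (y - X *v b)) - x * (w \<bullet> (?W *v w))" for x
    by (simp add: B_def w_def matrix_vector_right_distrib matrix_vector_mult_diff_distrib
        matrix_vector_mult_scaleR inner_diff_right inner_add_right)
  have sign: "(f x \<le> 0 \<longleftrightarrow> 0 \<le> u' x * B x) \<and> (0 \<le> f x \<longleftrightarrow> u' x * B x \<le> 0)"
    if "u' = (\<lambda>x. u (mahal C (b + x *\<^sub>R v) (y, X) / t))" for u' x
    using t by (simp add: that f_def B_def w_def field_simps)
  define u' where "u' = (\<lambda>x. u (mahal C (b + x *\<^sub>R v) (y, X) / t))"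
  have u': "0 \<le> u' x \<or> B x = 0" for x
  proof (cases "y - X *v (b + x *\<^sub>R v) = 0")
    case False
    then have "0 < mahal C (b + x *\<^sub>R v) (y, X) / t"
      using PDS_inner_pos[OF W False] t by (simp add: mahal_def)
    then show ?thesis using weight_nonneg by (simp add: u'_def)
  qed (simp add: B_def)
  note sgn = sign[OF u'_def]
  show ?thesis
  proof (cases "w = 0")
    case True
    then show ?thesis by (intro exI[of _ 0]) (simp add: sgn B)
  next
    case False
    then have pos: "0 < w \<bullet> (?W *v w)" by (rule PDS_inner_pos[OF W])
    let ?m = "w \<bullet> (?W *v (y - X *v b)) / (w \<bullet> (?W *v w))"
    have "f x \<le> 0" if "x \<le> ?m" for x
    proof -
      have "0 \<le> B x" using that pos by (simp add: B field_simps)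
      then show ?thesis using u'[of x] by (auto simp: sgn)
    qed
    moreover have "0 \<le> f x" if "?m \<le> x" for x
    proof -
      have "B x \<le> 0" using that pos by (simp add: B field_simps)
      then show ?thesis using u'[of x] by (auto simp: sgn mult_nonneg_nonpos)
    qed
    ultimately show ?thesis by blast
  qed
qed

lemma loss_mahal_measurable [measurable]:
  "(\<lambda>z. \<rho> (mahal C b z / t)) \<in> borel_measurable borel"
  unfolding divide_inverse
  by (intro borel_measurable_continuous_onI continuous_on_compose2[OF loss_continuous]
      continuous_on_mult continuous_on_mahal continuous_on_const continuous_on_id) auto

text \<open>The score is integrable at each parameter near \<open>b\<close>, but possibly not uniformly so. What allows
  the interchange of derivative and integral is the unimodality of the loss along the line.\<close>

lemma risk_has_directional_derivative:
  fixes P :: "('k::finite, 'q::finite) datum measure" and v :: "real ^ 'q"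
  assumes P: "prob_space P" "sets P = sets borel" and C: "V g \<in> PDS" and t: "t > 0" and e: "e > 0"
    and int: "\<And>b'. b' \<in> ball b e \<Longrightarrow> integrable P (\<lambda>z. Psi_beta u V z (b', g) t)"
    and cont: "continuous_on (ball b e) (\<lambda>b'. Lambda_beta u V P (b', g) t)"
  shows "((\<lambda>\<tau>. \<integral>z. \<rho> (mahal (V g) (b + \<tau> *\<^sub>R v) z / t) \<partial>P) has_real_derivative
    - (v \<bullet> Lambda_beta u V P (b, g) t) / t\<^sup>2) (at 0)"
proof -
  define f where "f = (\<lambda>z \<tau>. - (v \<bullet> Psi_beta u V z (b + \<tau> *\<^sub>R v, g) t) / t\<^sup>2)"
  have f_eq: "f (y, X) = (\<lambda>\<tau>. - u (mahal (V g) (b + \<tau> *\<^sub>R v) (y, X) / t) *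
      ((X *v v) \<bullet> (matrix_inv (V g) *v (y - X *v (b + \<tau> *\<^sub>R v)))) / t\<^sup>2)" for y X
    by (simp add: f_def Psi_beta_inner)
  \<comment> \<open>A step size for which the segment stays in the ball; the \<open>+ 1\<close> covers \<open>v = 0\<close>.\<close>
  define r where "r = e / (2 * (norm v + 1))"
  have r: "r > 0" using e by (simp add: r_def add_nonneg_pos)
  have in_ball: "b + x *\<^sub>R v \<in> ball b e" if "x \<in> {-r..r}" for x
  proof -
    have "norm (x *\<^sub>R v) \<le> r * norm v" using that by (auto simp: abs_le_iff intro!: mult_right_mono)
    also have "\<dots> < r * (2 * (norm v + 1))" using r by (intro mult_strict_left_mono) (auto simp: add_strict_increasing2)
    also have "\<dots> = e"
    proof -
      have "norm v + 1 \<noteq> 0" using norm_ge_zero[of v] by linarith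
      then show ?thesis by (simp add: r_def)
    qed
    finally show ?thesis by (simp add: dist_norm)
  qed
  have int_f: "(\<integral>z. f z x \<partial>P) = - (v \<bullet> Lambda_beta u V P (b + x *\<^sub>R v, g) t) / t\<^sup>2"
    if "x \<in> {-r..r}" for x
    using int[OF in_ball[OF that]] by (simp add: f_def Lambda_beta_def)
  have "((\<lambda>\<tau>. \<integral>z. \<rho> (mahal (V g) (b + \<tau> *\<^sub>R v) z / t) \<partial>P) has_real_derivative (\<integral>z. f z 0 \<partial>P)) (at 0)"
  proof (rule unimodal_integral_has_derivative[OF P(1) _ _ _ _ _ nonneg bounded r])
    have "continuous_on UNIV (\<lambda>p. f (fst p) (snd p))"
      unfolding f_def
      by (intro continuous_intros continuous_on_Psi_beta[OF weight_continuous]) (use t in auto)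
    then have "case_prod f \<in> borel_measurable (borel \<Otimes>\<^sub>M borel)"
      unfolding borel_prod case_prod_beta by (rule borel_measurable_continuous_onI)
    moreover have "sets (P \<Otimes>\<^sub>M (borel :: real measure)) = sets (borel \<Otimes>\<^sub>M borel)"
      using P(2) by (rule sets_pair_measure_cong) simp
    ultimately show "case_prod f \<in> borel_measurable (P \<Otimes>\<^sub>M borel)"
      by (simp cong: measurable_cong_sets)
    show "(\<lambda>z. \<rho> (mahal (V g) (b + x *\<^sub>R v) z / t)) \<in> borel_measurable P" for x
      using P(2) by (simp add: loss_mahal_measurable cong: measurable_cong_sets)
    fix z :: "('k, 'q) datum"
    obtain y X where z: "z = (y, X)" by (cases z)
    show "((\<lambda>\<tau>. \<rho> (mahal (V g) (b + \<tau> *\<^sub>R v) z / t)) has_real_derivative f z x) (at x)" for x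
      unfolding z f_eq by (rule mahal_shift_has_derivative[OF C t])
    show "continuous_on UNIV (f z)"
      unfolding f_def
      by (intro continuous_intros continuous_on_Psi_beta[OF weight_continuous]) (use t in auto)
    show "\<exists>m. (\<forall>x\<le>m. f z x \<le> 0) \<and> (\<forall>x\<ge>m. 0 \<le> f z x)"
      unfolding z f_eq by (rule mahal_shift_unimodal[OF C t])
  next
    have "continuous_on {-r..r} (\<lambda>x. - (v \<bullet> Lambda_beta u V P (b + x *\<^sub>R v, g) t) / t\<^sup>2)"
      by (intro continuous_intros continuous_on_compose2[OF cont]) (use in_ball t in auto)
    then show "continuous_on {-r..r} (\<lambda>x. \<integral>z. f z x \<partial>P)"
      by (rule continuous_on_eq) (simp add: int_f)
  qed
  then show ?thesis using int_f[of 0] r by simp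
qed

text \<open>The estimating equation. It is obtained by differentiating in a single direction, namely the
  vector \<open>v\<close> that is to vanish: the derivative is \<open>- (v \<bullet> v) / t\<^sup>2\<close>, and it is zero at a local
  minimum.\<close>

lemma contaminated_risk_stationary:
  fixes P :: "('k::finite, 'q::finite) datum measure"
  assumes P: "prob_space P" "sets P = sets borel" and C: "V g \<in> PDS" and t: "t > 0" and e: "e > 0"
    and h: "0 \<le> h" "h \<le> 1"
    and int: "\<And>b'. b' \<in> ball b e \<Longrightarrow> integrable P (\<lambda>z. Psi_beta u V z (b', g) t)"
    and cont: "continuous_on (ball b e) (\<lambda>b'. Lambda_beta u V P (b', g) t)"
    and min: "\<And>b'. b' \<in> ball b e \<Longrightarrow>
      (\<integral>z. \<rho> (mahal (V g) b z / t) \<partial>contam P s h) \<le> (\<integral>z. \<rho> (mahal (V g) b' z / t) \<partial>contam P s h)"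
  shows "(1 - h) *\<^sub>R Lambda_beta u V P (b, g) t + h *\<^sub>R Psi_beta u V s (b, g) t = 0"
proof -
  let ?L = "Lambda_beta u V P (b, g) t" and ?Psi = "Psi_beta u V s (b, g) t"
  define v where "v = (1 - h) *\<^sub>R ?L + h *\<^sub>R ?Psi"
  define G where "G = (\<lambda>\<tau>. \<integral>z. \<rho> (mahal (V g) (b + \<tau> *\<^sub>R v) z / t) \<partial>contam P s h)"
  obtain y X where s: "s = (y, X)" by (cases s)
  have G: "G = (\<lambda>\<tau>. (1 - h) * (\<integral>z. \<rho> (mahal (V g) (b + \<tau> *\<^sub>R v) z / t) \<partial>P) +
      h * \<rho> (mahal (V g) (b + \<tau> *\<^sub>R v) s / t))"
    unfolding G_def by (intro ext integral_contam[where M = M] P h loss_mahal_measurable nonneg bounded)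
  have "(G has_real_derivative (1 - h) * (- (v \<bullet> ?L) / t\<^sup>2) + h * (- (v \<bullet> ?Psi) / t\<^sup>2)) (at 0)"
    unfolding G
  proof (intro DERIV_add DERIV_cmult risk_has_directional_derivative[OF P C t e int cont])
    show "((\<lambda>\<tau>. \<rho> (mahal (V g) (b + \<tau> *\<^sub>R v) s / t)) has_real_derivative - (v \<bullet> ?Psi) / t\<^sup>2) (at 0)"
      using mahal_shift_has_derivative[where C = "V g" and t = t and b = b and v = v and y = y and X = X and x = 0] C t
      by (simp add: s Psi_beta_inner)
  qed
  also have "(1 - h) * (- (v \<bullet> ?L) / t\<^sup>2) + h * (- (v \<bullet> ?Psi) / t\<^sup>2) = - (v \<bullet> v) / t\<^sup>2"
  proof -
    have "v \<bullet> v = (1 - h) * (v \<bullet> ?L) + h * (v \<bullet> ?Psi)"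
      by (subst (2) v_def) (simp add: inner_add_right)
    then show ?thesis by (simp add: add_divide_distrib diff_divide_distrib)
  qed
  finally have dG: "(G has_real_derivative - (v \<bullet> v) / t\<^sup>2) (at 0)" .
  have "\<forall>\<^sub>F \<tau> in nhds 0. b + \<tau> *\<^sub>R v \<in> ball b e"
  proof -
    have "((\<lambda>\<tau>. b + \<tau> *\<^sub>R v) \<longlongrightarrow> b + 0 *\<^sub>R v) (nhds 0)"
      by (intro tendsto_intros filterlim_ident)
    then show ?thesis using e by (intro topological_tendstoD[where l = b]) auto
  qed
  then obtain d where d: "d > 0" "\<And>\<tau>. \<bar>\<tau>\<bar> < d \<Longrightarrow> b + \<tau> *\<^sub>R v \<in> ball b e"
    by (auto simp: eventually_nhds_metric dist_real_def)
  have "- (v \<bullet> v) / t\<^sup>2 = 0"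
  proof (rule DERIV_local_min[OF dG d(1)], safe)
    fix \<tau> assume "\<bar>0 - \<tau>\<bar> < d"
    then have "b + \<tau> *\<^sub>R v \<in> ball b e" by (intro d(2)) simp
    from min[OF this] show "G 0 \<le> G \<tau>" by (simp add: G_def)
  qed
  then show ?thesis using t by (simp add: v_def)
qed

end

section \<open>Reflection at a point of symmetry\<close>

text \<open>A conditional distribution is specified through its values on rectangles. These generate the
  Borel sets of the product and are closed under intersection, so \<open>P\<close> disintegrates over all Borel
  sets. Sets moved by a reflection that depends on \<open>X\<close> are no longer rectangles, hence the need.\<close>

lemma cond_distr_eq_bind:
  fixes P :: "('y::second_countable_topology \<times> 'x::second_countable_topology) measure"
  assumes P: "prob_space P" "sets P = sets borel" and K: "cond_distr P K"
  shows "P = distr P borel snd \<bind> (\<lambda>X. distr (K X) borel (\<lambda>y. (y, X)))" (is "P = ?Q")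
    and "(\<lambda>X. distr (K X) borel (\<lambda>y. (y, X))) \<in> distr P borel snd \<rightarrow>\<^sub>M subprob_algebra borel"
proof -
  interpret prob_space P by fact
  let ?PX = "distr P borel snd"
  have Km: "K \<in> borel \<rightarrow>\<^sub>M subprob_algebra borel"
    using K by (auto simp: cond_distr_def intro: measurable_prob_algebraD)
  have "(\<lambda>X. distr (K X) borel (\<lambda>y. (y, X))) \<in> borel \<rightarrow>\<^sub>M subprob_algebra borel"
  proof (rule measurable_distr2[OF _ Km])
    show "(\<lambda>(X, y). (y, X)) \<in> (borel :: 'x measure) \<Otimes>\<^sub>M (borel :: 'y measure) \<rightarrow>\<^sub>M borel"
      unfolding borel_prod[symmetric] by measurable
  qed
  then show N: "(\<lambda>X. distr (K X) borel (\<lambda>y. (y, X))) \<in> ?PX \<rightarrow>\<^sub>M subprob_algebra borel"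
    by (simp cong: measurable_cong_sets)
  have Kb: "sets (K X) = sets borel" for X
    using sets_kernel[OF Km, of X] by simp
  let ?E = "{A \<times> B | A B. A \<in> sets (borel :: 'y measure) \<and> B \<in> sets (borel :: 'x measure)}"
  have gen: "sets (borel :: ('y \<times> 'x) measure) = sigma_sets UNIV ?E"
    unfolding borel_prod[symmetric] by (simp add: sets_pair_measure)
  show "P = ?Q"
  proof (rule measure_eqI_generator_eq[where E = ?E and \<Omega> = UNIV and A = "\<lambda>_. UNIV"])
    show "Int_stable ?E" by (rule Int_stable_pair_measure_generator)
    show "sets P = sigma_sets UNIV ?E" using P(2) gen by simp
    show "sets ?Q = sigma_sets UNIV ?E"
      using sets_bind[of ?PX "\<lambda>X. distr (K X) borel (\<lambda>y. (y, X))" borel] gen by simp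
    show "range (\<lambda>_. UNIV) \<subseteq> ?E"
      by (auto intro!: exI[of _ UNIV])
    fix C assume "C \<in> ?E"
    then obtain A B where C: "C = A \<times> B" and A [measurable]: "A \<in> sets borel" and B [measurable]: "B \<in> sets borel"
      by auto
    have Cs: "A \<times> B \<in> sets borel" unfolding borel_prod[symmetric] by simp
    have "emeasure ?Q C = (\<integral>\<^sup>+X. emeasure (distr (K X) borel (\<lambda>y. (y, X))) C \<partial>?PX)"
      unfolding C by (rule emeasure_bind[OF _ N Cs]) simp
    also have "\<dots> = (\<integral>\<^sup>+X. emeasure (K X) A * indicator B X \<partial>?PX)"
    proof (rule nn_integral_cong)
      fix X
      have "(\<lambda>y. (y, X)) \<in> K X \<rightarrow>\<^sub>M borel"
        using Kb[of X] unfolding borel_prod[symmetric] by (simp cong: measurable_cong_sets)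
      moreover have "(\<lambda>y. (y, X)) -` (A \<times> B) \<inter> space (K X) = (if X \<in> B then A else {})"
        using sets_eq_imp_space_eq[OF Kb[of X]] by auto
      ultimately show "emeasure (distr (K X) borel (\<lambda>y. (y, X))) C = emeasure (K X) A * indicator B X"
        by (simp add: C emeasure_distr Cs)
    qed
    also have "\<dots> = emeasure P C"
      using K A B unfolding C cond_distr_def by simp
    finally show "emeasure P C = emeasure ?Q C" ..
  qed (use emeasure_finite in auto)
qed

text \<open>On the slice at \<open>X\<close> the map is the reflection at \<open>X b\<close>, which preserves the conditional
  distribution for almost every \<open>X\<close>.\<close>

lemma point_of_symmetry_reflection:
  fixes P :: "('k::finite, 'q::finite) datum measure"
  assumes P: "prob_space P" "sets P = sets borel" and b: "point_of_symmetry P b"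
  shows "distr P borel (\<lambda>(y, X). (2 *\<^sub>R (X *v b) - y, X)) = P" (is "distr P borel ?T = P")
proof (rule measure_eqI)
  interpret prob_space P by fact
  let ?PX = "distr P borel snd"
  obtain K where K: "cond_distr P K" and sym: "AE X in ?PX. \<forall>A\<in>sets borel.
      measure (K X) ((\<lambda>y. X *v b + y) ` A) = measure (K X) ((\<lambda>y. X *v b - y) ` A)"
    using b unfolding point_of_symmetry_def by blast
  let ?N = "\<lambda>X. distr (K X) borel (\<lambda>y. (y, X))"
  note bind = cond_distr_eq_bind(1)[OF P K] and N = cond_distr_eq_bind(2)[OF P K]
  have Km: "K \<in> borel \<rightarrow>\<^sub>M prob_algebra borel" using K by (simp add: cond_distr_def)
  have Kp: "prob_space (K X)" and Kb: "sets (K X) = sets borel" for X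
    using measurable_space[OF Km, of X] by (auto simp: space_prob_algebra)
  have T: "?T \<in> borel \<rightarrow>\<^sub>M borel"
    unfolding case_prod_beta
    by (intro borel_measurable_continuous_onI continuous_intros)
  show "sets (distr P borel ?T) = sets P" using P(2) by simp
  fix C assume "C \<in> sets (distr P borel ?T)"
  then have C: "C \<in> sets borel" by simp
  have pre: "?T -` C \<in> sets borel" using measurable_sets[OF T C] by simp
  have pair: "(\<lambda>y. (y, X)) \<in> K X \<rightarrow>\<^sub>M borel" for X
    using Kb[of X] unfolding borel_prod[symmetric] by (simp cong: measurable_cong_sets)
  have slice: "emeasure (?N X) D = emeasure (K X) {y. (y, X) \<in> D}" if "D \<in> sets borel" for D X
    using that sets_eq_imp_space_eq[OF Kb[of X]]
    by (subst emeasure_distr[OF pair]) (auto intro!: arg_cong[where f = "emeasure (K X)"])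
  have emP: "emeasure P D = (\<integral>\<^sup>+X. emeasure (?N X) D \<partial>?PX)" if "D \<in> sets borel" for D
    by (subst bind) (rule emeasure_bind[OF _ N that], simp)
  have "emeasure (distr P borel ?T) C = emeasure P (?T -` C)"
    using T P(2) C sets_eq_imp_space_eq[OF P(2)]
    by (subst emeasure_distr) (simp_all cong: measurable_cong_sets)
  also have "\<dots> = (\<integral>\<^sup>+X. emeasure (?N X) (?T -` C) \<partial>?PX)" by (rule emP[OF pre])
  also have "\<dots> = (\<integral>\<^sup>+X. emeasure (?N X) C \<partial>?PX)"
  proof (rule nn_integral_cong_AE, use sym in eventually_elim)
    fix X assume X: "\<forall>A\<in>sets borel.
      measure (K X) ((\<lambda>y. X *v b + y) ` A) = measure (K X) ((\<lambda>y. X *v b - y) ` A)"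
    interpret KX: prob_space "K X" by (rule Kp)
    \<comment> \<open>The slice of \<open>C\<close> is \<open>X b + A\<close>, and its reflection is \<open>X b - A\<close>.\<close>
    define A where "A = {r. (X *v b + r, X) \<in> C}"
    have "(\<lambda>r. (X *v b + r, X)) \<in> borel \<rightarrow>\<^sub>M borel"
      by (intro borel_measurable_continuous_onI continuous_intros)
    from measurable_sets[OF this C] have A: "A \<in> sets borel" by (simp add: A_def vimage_def)
    have "(\<lambda>y. X *v b + y) ` A = {y. (y, X) \<in> C}"
      by (auto simp: A_def image_iff intro!: exI[of _ "_ - X *v b"])
    moreover have "(\<lambda>y. X *v b - y) ` A = {y. (y, X) \<in> ?T -` C}"
      by (auto simp: A_def image_iff scaleR_2 algebra_simps intro!: exI[of _ "X *v b - _"])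
    ultimately show "emeasure (?N X) (?T -` C) = emeasure (?N X) C"
      using bspec[OF X A] by (simp only: slice[OF C] slice[OF pre] KX.emeasure_eq_measure)
  qed
  also have "\<dots> = emeasure P C" by (rule emP[OF C, symmetric])
  finally show "emeasure (distr P borel ?T) C = emeasure P C" .
qed

text \<open>The score depends on the residual \<open>y - X b\<close> as an odd function, and the reflection negates
  the residual. As this holds for all \<open>g\<close> and \<open>t \<noteq> 0\<close>, an error in the estimated scatter and scale
  cannot shift the zero of \<open>\<Lambda>\<close> in \<open>b\<close>.\<close>

lemma Lambda_beta_point_of_symmetry:
  fixes P :: "('k::finite, 'q::finite) datum measure"
  assumes P: "prob_space P" "sets P = sets borel" and b: "point_of_symmetry P b"
    and u: "continuous_on UNIV u" and t: "t \<noteq> 0"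
  shows "Lambda_beta u V P (b, g) t = 0"
proof -
  let ?T = "\<lambda>(y :: real ^ 'k, X :: real ^ 'q ^ 'k). (2 *\<^sub>R (X *v b) - y, X)"
  have odd: "Psi_beta u V (?T z) (b, g) t = - Psi_beta u V z (b, g) t" for z
  proof (cases z)
    case (Pair y X)
    have "2 *\<^sub>R (X *v b) - y - X *v b = - (y - X *v b)" by (simp add: scaleR_2)
    then show ?thesis
      by (simp only: Pair Psi_beta_def mahal_def prod.case vec.neg inner_minus_left
          inner_minus_right minus_minus scaleR_minus_right)
  qed
  have T: "?T \<in> P \<rightarrow>\<^sub>M borel"
    using P(2) unfolding case_prod_beta
    by (auto cong: measurable_cong_sets intro!: borel_measurable_continuous_onI continuous_intros)
  have "(\<lambda>z. Psi_beta u V z (b, g) t) \<in> borel_measurable borel"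
    by (intro borel_measurable_continuous_onI continuous_on_Psi_beta u t continuous_intros)
  from integral_distr[OF T this]
  have "Lambda_beta u V P (b, g) t = (\<integral>z. Psi_beta u V (?T z) (b, g) t \<partial>P)"
    by (simp only: point_of_symmetry_reflection[OF P b] Lambda_beta_def)
  also have "\<dots> = - Lambda_beta u V P (b, g) t"
    by (simp only: odd Lambda_beta_def Bochner_Integration.integral_minus)
  finally show ?thesis by (simp add: eq_neg_iff_add_eq_0 flip: scaleR_2)
qed

section \<open>Linearisation in the regression parameter\<close>

text \<open>A derivative relative to \<open>S\<close> need not be unique, but if \<open>S\<close> contains the whole slice in the
  first coordinate, then its restriction to that coordinate is an ordinary derivative.\<close>

lemma has_derivative_slice:
  fixes f :: "('a::real_normed_vector \<times> 'b::real_normed_vector) \<times> 'c::real_normed_vector \<Rightarrow> 'd::real_normed_vector"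
  assumes f: "(f has_derivative f') (at ((b, g), t) within S)"
    and S: "\<And>b'. ((b', g), t) \<in> S"
  shows "((\<lambda>b. f ((b, g), t)) has_derivative (\<lambda>v. f' ((v, 0), 0))) (at b)"
proof -
  have "(f has_derivative f') (at ((b, g), t) within range (\<lambda>b. ((b, g), t)))"
    by (rule has_derivative_subset[OF f]) (use S in auto)
  moreover have "((\<lambda>b. ((b, g), t)) has_derivative (\<lambda>v. ((v, 0), 0))) (at b)"
    by (intro has_derivative_Pair has_derivative_ident has_derivative_const)
  ultimately show ?thesis
    using has_derivative_in_compose[of "\<lambda>b. ((b, g), t)"] by fastforce
qed

text \<open>Partial differentiability in the first coordinate, uniform in the other two. The derivative
  \<open>D\<close> at the centre serves for all nearby \<open>(g, t)\<close>, because the partial derivatives are close to \<open>D\<close>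
  and the mean value inequality is applied along the first coordinate with \<open>(g, t)\<close> fixed.\<close>

lemma C1_near_within_slice:
  fixes f :: "('a::real_normed_vector \<times> 'b::real_normed_vector) \<times> 'c::real_normed_vector \<Rightarrow> 'd::real_normed_vector"
  assumes C1: "C1_near_within f ((b0, g0), t0) S"
    and S: "\<And>b b' g t. ((b, g), t) \<in> S \<Longrightarrow> ((b', g), t) \<in> S" and S0: "((b0, g0), t0) \<in> S"
    and D: "((\<lambda>b. f ((b, g0), t0)) has_derivative D) (at b0)" and \<epsilon>: "\<epsilon> > 0"
  obtains \<delta> where "\<delta> > 0"
    and "\<And>b g t. ((b, g), t) \<in> S \<inter> ball ((b0, g0), t0) \<delta> \<Longrightarrow> isCont (\<lambda>b. f ((b, g), t)) b"
    and "\<And>b g t. ((b, g), t) \<in> S \<inter> ball ((b0, g0), t0) \<delta> \<Longrightarrow>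
      norm (f ((b, g), t) - f ((b0, g), t) - D (b - b0)) \<le> \<epsilon> * norm (b - b0)"
proof -
  let ?z0 = "((b0, g0), t0)"
  obtain U f' where U: "open U" "?z0 \<in> U"
    and f': "\<And>z. z \<in> U \<inter> S \<Longrightarrow> (f has_derivative blinfun_apply (f' z)) (at z within S)"
    and cont: "continuous_on (U \<inter> S) f'"
    using C1 unfolding C1_near_within_def by blast
  obtain \<delta>1 where \<delta>1: "\<delta>1 > 0" "\<And>z. z \<in> U \<inter> S \<Longrightarrow> dist z ?z0 < \<delta>1 \<Longrightarrow> dist (f' z) (f' ?z0) < \<epsilon>"
    using cont U(2) S0 \<epsilon> unfolding continuous_on_iff by (metis IntI)
  obtain \<delta>2 where \<delta>2: "\<delta>2 > 0" "ball ?z0 \<delta>2 \<subseteq> U"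
    using U by (meson openE)
  define \<delta> where "\<delta> = min \<delta>1 \<delta>2"
  have slice: "((\<lambda>b. f ((b, g), t)) has_derivative (\<lambda>v. f' ((b, g), t) ((v, 0), 0))) (at b)"
    if "((b, g), t) \<in> S \<inter> ball ?z0 \<delta>" for b g t
    by (rule has_derivative_slice[OF f']) (use that \<delta>2(2) S in \<open>auto simp: \<delta>_def\<close>)
  have D_eq: "D = (\<lambda>v. f' ?z0 ((v, 0), 0))"
    using has_derivative_unique[OF D slice[of b0 g0 t0]] S0 \<delta>1(1) \<delta>2(1) by (simp add: \<delta>_def)
  have lin: "bounded_linear D" using D by (rule has_derivative_bounded_linear)
  show thesis
  proof
    show "\<delta> > 0" using \<delta>1(1) \<delta>2(1) by (simp add: \<delta>_def)
    show "isCont (\<lambda>b. f ((b, g), t)) b" if "((b, g), t) \<in> S \<inter> ball ?z0 \<delta>" for b g t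
      using has_derivative_continuous[OF slice[OF that]] .
    fix b g t assume z: "((b, g), t) \<in> S \<inter> ball ?z0 \<delta>"
    define B where "B = {b. ((b, g), t) \<in> ball ?z0 \<delta>}"
    have inS: "((b', g), t) \<in> S" for b' using z S by blast
    have "convex B"
    proof (rule convexI)
      fix x y and p q :: real
      assume *: "x \<in> B" "y \<in> B" "0 \<le> p" "0 \<le> q" "p + q = 1"
      have "p *\<^sub>R ((x, g), t) + q *\<^sub>R ((y, g), t) \<in> ball ?z0 \<delta>"
        by (rule convexD[OF convex_ball]) (use * in \<open>auto simp: B_def\<close>)
      moreover have "p *\<^sub>R ((x, g), t) + q *\<^sub>R ((y, g), t) = ((p *\<^sub>R x + q *\<^sub>R y, g), t)"
        using *(5) by (simp add: scaleR_add_left[symmetric])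
      ultimately show "p *\<^sub>R x + q *\<^sub>R y \<in> B" by (simp add: B_def)
    qed
    have "norm ((f ((b, g), t) - D b) - (f ((b0, g), t) - D b0)) \<le> \<epsilon> * norm (b - b0)"
    proof (rule differentiable_bound[OF \<open>convex B\<close>,
          where f = "\<lambda>b. f ((b, g), t) - D b" and f' = "\<lambda>b' v. f' ((b', g), t) ((v, 0), 0) - D v"])
      fix b' assume b': "b' \<in> B"
      then have z': "((b', g), t) \<in> S \<inter> ball ?z0 \<delta>" using inS by (simp add: B_def)
      show "((\<lambda>b. f ((b, g), t) - D b) has_derivative
          (\<lambda>v. f' ((b', g), t) ((v, 0), 0) - D v)) (at b' within B)"
        by (intro has_derivative_diff has_derivative_at_withinI[OF slice[OF z']]
            bounded_linear_imp_has_derivative[OF lin])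
      show "onorm (\<lambda>v. f' ((b', g), t) ((v, 0), 0) - D v) \<le> \<epsilon>"
      proof (rule onorm_bound)
        fix v
        have "norm (f' ((b', g), t) ((v, 0), 0) - D v) = norm ((f' ((b', g), t) - f' ?z0) ((v, 0), 0))"
          by (simp add: D_eq blinfun.diff_left)
        also have "\<dots> \<le> norm (f' ((b', g), t) - f' ?z0) * norm (((v, 0), 0) :: ('a \<times> 'b) \<times> 'c)"
          by (rule norm_blinfun)
        also have "\<dots> \<le> \<epsilon> * norm v"
          using \<delta>1(2)[of "((b', g), t)"] z' \<delta>2(2)
          by (intro mult_mono) (auto simp: \<delta>_def dist_commute dist_norm norm_Pair subset_iff less_imp_le \<epsilon>)
        finally show "norm (f' ((b', g), t) ((v, 0), 0) - D v) \<le> \<epsilon> * norm v" .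
      qed (use \<epsilon> in simp)
    next
      show "b \<in> B" using z by (simp add: B_def)
      have "dist ?z0 ((b0, g), t) \<le> dist ?z0 ((b, g), t)"
        unfolding dist_Pair_Pair by (intro real_sqrt_le_mono add_mono power_mono) auto
      then show "b0 \<in> B" using z by (simp add: B_def)
    qed
    then show "norm (f ((b, g), t) - f ((b0, g), t) - D (b - b0)) \<le> \<epsilon> * norm (b - b0)"
      by (simp add: linear_diff[OF bounded_linear.linear[OF lin]] algebra_simps)
  qed
qed

text \<open>The error \<open>e\<close> is only known to be small relative to the unknown \<open>x\<close>. Choosing
  \<open>\<epsilon> = 1 / (2 K)\<close>, where \<open>K\<close> bounds the inverse of \<open>D\<close>, lets half of the norm of \<open>x\<close> absorb it and
  so bounds \<open>x\<close>; then \<open>e\<close> tends to zero and the equation can be solved in the limit.\<close>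

lemma perturbed_linear_equation_tendsto:
  fixes D :: "real ^ 'n ^ 'n" and x e y :: "'a \<Rightarrow> real ^ 'n"
  assumes D: "invertible D"
    and eq: "\<forall>\<^sub>F a in F. D *v x a + e a = y a"
    and small: "\<And>\<epsilon>. \<epsilon> > 0 \<Longrightarrow> \<forall>\<^sub>F a in F. norm (e a) \<le> \<epsilon> * norm (x a)"
    and y: "(y \<longlongrightarrow> l) F"
  shows "(x \<longlongrightarrow> matrix_inv D *v l) F"
proof -
  let ?W = "matrix_inv D"
  obtain K where K: "K > 0" "\<And>v. norm (?W *v v) \<le> norm v * K"
    using bounded_linear.pos_bounded[OF matrix_vector_mul_bounded_linear[of ?W]] by blast
  have solve: "\<forall>\<^sub>F a in F. x a = ?W *v (y a - e a)"
    using eq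
  proof eventually_elim
    case (elim a)
    then have "y a - e a = D *v x a" by (simp add: algebra_simps)
    then show ?case by (simp add: matrix_vector_mul_assoc matrix_inv_invertible[OF D])
  qed
  have bound: "\<forall>\<^sub>F a in F. norm (x a) \<le> 2 * K * (norm l + 1)"
  proof -
    have "\<forall>\<^sub>F a in F. norm (e a) \<le> 1 / (2 * K) * norm (x a)" using K by (intro small) simp
    moreover have "\<forall>\<^sub>F a in F. norm (y a) < norm l + 1"
      using order_tendstoD(2)[OF tendsto_norm[OF y]] by simp
    ultimately show ?thesis
      using solve
    proof eventually_elim
      case (elim a)
      have "norm (x a) \<le> norm (y a - e a) * K" using K(2)[of "y a - e a"] elim(3) by simp
      also have "\<dots> \<le> (norm (y a) + norm (e a)) * K"
        using K(1) by (intro mult_right_mono norm_triangle_ineq4) simp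
      also have "\<dots> \<le> (norm l + 1 + 1 / (2 * K) * norm (x a)) * K"
        using K(1) elim by (intro mult_right_mono add_mono) auto
      also have "\<dots> = K * (norm l + 1) + norm (x a) / 2" using K(1) by (simp add: field_simps)
      finally show ?case by (simp add: field_simps)
    qed
  qed
  have "(e \<longlongrightarrow> 0) F"
  proof (rule tendstoI)
    fix r :: real assume r: "r > 0"
    define B where "B = 2 * K * (norm l + 1)"
    have B: "B > 0" unfolding B_def using K(1) norm_ge_zero[of l] by (simp add: add_nonneg_pos)
    have "\<forall>\<^sub>F a in F. norm (e a) \<le> r / (2 * B) * norm (x a)" using r B by (intro small divide_pos_pos) auto
    then show "\<forall>\<^sub>F a in F. dist (e a) 0 < r"
      using bound[folded B_def]
    proof eventually_elim
      case (elim a)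
      have "norm (e a) \<le> r / (2 * B) * B"
        using elim r B by (meson divide_nonneg_nonneg less_imp_le mult_left_mono order_trans zero_le_mult_iff zero_le_numeral)
      also have "\<dots> = r / 2" using B by simp
      also have "\<dots> < r" using r by simp
      finally show ?case by simp
    qed
  qed
  then have "((\<lambda>a. y a - e a) \<longlongrightarrow> l) F"
    using tendsto_diff[OF y] by fastforce
  then have "((\<lambda>a. ?W *v (y a - e a)) \<longlongrightarrow> ?W *v l) F"
    by (rule isCont_tendsto_compose[OF matrix_vector_mult_linear_continuous_at])
  then show ?thesis
    by (rule Lim_transform_eventually) (use solve in eventually_elim, simp)
qed

section \<open>The influence function\<close>

theorem theorem5:
  fixes P :: "('k::finite, 'q::finite) datum measure"
    and \<Theta> :: "(real ^ 'l::finite) set"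
    and V :: "real ^ 'l \<Rightarrow> real ^ 'k ^ 'k"
    and \<rho>0 \<rho>1 u1 :: "real \<Rightarrow> real"
    and b0 :: real
    and \<beta>0 \<beta>1 :: "('k, 'q) datum measure \<Rightarrow> real ^ 'q"
    and \<theta>0 \<gamma> :: "('k, 'q) datum measure \<Rightarrow> real ^ 'l"
    and \<sigma> :: "('k, 'q) datum measure \<Rightarrow> real"
    and s :: "('k, 'q) datum"
    and D :: "real ^ 'q ^ 'q"
  assumes P: "prob_space P" "sets P = sets borel"
    and V: "V \<in> \<Theta> \<rightarrow> PDS" "inj_on V \<Theta>" "continuous_on \<Theta> V"
    and \<rho>: "loss_function \<rho>0" "loss_function \<rho>1"
      "\<And>t. \<rho>1 t / Sup (range \<rho>1) \<le> \<rho>0 t / Sup (range \<rho>0)"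
    and b0: "0 < b0" "b0 < Sup (range \<rho>0)"
    and \<rho>1_C1: "\<And>t. \<rho>1 differentiable (at t)" "continuous_on UNIV (deriv \<rho>1)"
    and u1: "\<And>t. t \<noteq> 0 \<Longrightarrow> u1 t = deriv \<rho>1 t / t" "continuous_on UNIV u1"
    and init: "\<And>Q. prob_space Q \<Longrightarrow> sets Q = sets borel \<Longrightarrow> \<theta>0 Q \<in> \<Theta>"
    and scale_P: "scale_solution \<rho>0 b0 V \<beta>0 \<theta>0 P (\<sigma> P)"
    and min_P: "local_min_on (param_dom \<Theta> V) (\<lambda>(b, g). R_obj \<rho>1 \<sigma> P b (V g)) (\<beta>1 P, \<gamma> P)"
    and scale_Ph: "\<forall>\<^sub>F h in at_right 0.
      scale_solution \<rho>0 b0 V \<beta>0 \<theta>0 (contam P s h) (\<sigma> (contam P s h))"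
    and min_Ph: "\<forall>\<^sub>F h in at_right 0.
      local_min_on (param_dom \<Theta> V) (\<lambda>(b, g). R_obj \<rho>1 \<sigma> (contam P s h) b (V g))
        (\<beta>1 (contam P s h), \<gamma> (contam P s h))"
    and conv: "((\<lambda>h. ((\<beta>1 (contam P s h), \<gamma> (contam P s h)), \<sigma> (contam P s h)))
      \<longlongrightarrow> ((\<beta>1 P, \<gamma> P), \<sigma> P)) (at_right 0)"
    and \<Lambda>_defined: "\<exists>U. open U \<and> ((\<beta>1 P, \<gamma> P), \<sigma> P) \<in> U \<and>
      (\<forall>(\<xi>, t) \<in> U \<inter> param_dom \<Theta> V \<times> {0<..}. integrable P (\<lambda>z. Psi_beta u1 V z \<xi> t))"
    and \<Lambda>_C1: "C1_near_within (\<lambda>(\<xi>, t). Lambda_beta u1 V P \<xi> t)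
      ((\<beta>1 P, \<gamma> P), \<sigma> P) (param_dom \<Theta> V \<times> {0<..})"
    and D: "((\<lambda>b. Lambda_beta u1 V P (b, \<gamma> P) (\<sigma> P)) has_derivative (\<lambda>v. D *v v)) (at (\<beta>1 P))"
      "invertible D"
    and symm: "point_of_symmetry P (\<beta>1 P)"
  shows "has_influence_function \<beta>1 P s
    (- (matrix_inv D *v Psi_beta u1 V s (\<beta>1 P, \<gamma> P) (\<sigma> P)))"
proof -
  obtain M where M: "\<rho>1 x \<le> M" for x
    using loss_function_bounded[OF \<rho>(2)] by blast
  have d\<rho>1: "(\<rho>1 has_real_derivative deriv \<rho>1 x) (at x)" for x
    using \<rho>1_C1(1) DERIV_deriv_iff_real_differentiable by blast
  interpret smooth_loss \<rho>1 "deriv \<rho>1" u1 M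
  proof
    fix x :: real
    show "0 \<le> u1 x" if "0 < x"
      using u1(1)[of x] loss_function_deriv_nonneg[OF \<rho>(2) d\<rho>1 that] that by simp
  qed (use \<rho>(2) M d\<rho>1 u1 in \<open>auto simp: loss_function_def\<close>)
  define bP where "bP = \<beta>1 P"
  define gP where "gP = \<gamma> P"
  define tP where "tP = \<sigma> P"
  define b where "b = (\<lambda>h. \<beta>1 (contam P s h))"
  define g where "g = (\<lambda>h. \<gamma> (contam P s h))"
  define t where "t = (\<lambda>h. \<sigma> (contam P s h))"
  define S where "S = (param_dom \<Theta> V :: ((real ^ 'q) \<times> (real ^ 'l)) set) \<times> {0 :: real<..}"
  note defs = bP_def[symmetric] gP_def[symmetric] tP_def[symmetric]
  let ?z0 = "((bP, gP), tP)" and ?w = "\<lambda>h. ((b h, g h), t h)"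
  let ?L = "\<lambda>b g t. Lambda_beta u1 V P (b, g) t"
  have S0: "?z0 \<in> S"
    using min_P scale_P by (simp add: S_def local_min_on_def scale_solution_def defs)
  have S_slice: "((b'', g'), t') \<in> S" if "((b', g'), t') \<in> S" for b' b'' g' t'
    using that by (simp add: S_def param_dom_def)
  have pds: "V g' \<in> PDS" "g' \<in> \<Theta>" "0 < t'" if "((b', g'), t') \<in> S" for b' g' t'
    using that by (auto simp: S_def param_dom_def)
  have conv': "(?w \<longlongrightarrow> ?z0) (at_right 0)"
    using conv by (simp only: b_def g_def t_def defs)
  have b: "(b \<longlongrightarrow> bP) (at_right 0)" and g: "(g \<longlongrightarrow> gP) (at_right 0)" and t: "(t \<longlongrightarrow> tP) (at_right 0)"
    using tendsto_fst[OF tendsto_fst[OF conv']] tendsto_snd[OF tendsto_fst[OF conv']]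
      tendsto_snd[OF conv'] by simp_all
  have in_S: "\<forall>\<^sub>F h in at_right 0. ?w h \<in> S"
    using min_Ph scale_Ph
    by eventually_elim (simp add: S_def local_min_on_def scale_solution_def b_def g_def t_def)
  have h01: "\<forall>\<^sub>F h in at_right 0. h \<in> {0<..<1::real}"
    by (rule eventually_at_right_real) simp
  have DL: "((\<lambda>b. (\<lambda>(\<xi>, t). Lambda_beta u1 V P \<xi> t) ((b, gP), tP)) has_derivative (\<lambda>v. D *v v)) (at bP)"
    using D(1) by (simp add: defs)
  have C1: "\<exists>\<delta>>0. (\<forall>b g t. ((b, g), t) \<in> S \<inter> ball ?z0 \<delta> \<longrightarrow> isCont (\<lambda>b. ?L b g t) b \<and>
      norm (?L b g t - ?L bP g t - D *v (b - bP)) \<le> \<epsilon> * norm (b - bP))" if "\<epsilon> > 0" for \<epsilon>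
    by (rule C1_near_within_slice[OF \<Lambda>_C1[folded S_def, unfolded defs] _ S0 DL that])
      (use S_slice in auto)

  have stationary: "\<forall>\<^sub>F h in at_right 0.
    (1 - h) *\<^sub>R ?L (b h) (g h) (t h) + h *\<^sub>R Psi_beta u1 V s (b h, g h) (t h) = 0"
  proof -
    obtain U where U: "open U" "?z0 \<in> U"
      and int: "\<And>b g t. ((b, g), t) \<in> U \<inter> S \<Longrightarrow> integrable P (\<lambda>z. Psi_beta u1 V z (b, g) t)"
      using \<Lambda>_defined unfolding defs S_def[symmetric] by blast
    obtain \<delta> where \<delta>: "\<delta> > 0"
      and cont: "\<And>b g t. ((b, g), t) \<in> S \<inter> ball ?z0 \<delta> \<Longrightarrow> isCont (\<lambda>b. ?L b g t) b"
      using C1[of 1] by auto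
    obtain \<eta> where \<eta>: "\<eta> > 0" "ball ?z0 \<eta> \<subseteq> U \<inter> ball ?z0 \<delta>"
      using openE[of "U \<inter> ball ?z0 \<delta>" ?z0] U \<delta> by auto
    have "\<forall>\<^sub>F h in at_right 0. dist (?w h) ?z0 < \<eta> / 2"
      using tendstoD[OF conv', of "\<eta> / 2"] \<eta>(1) by simp
    then show ?thesis
      using h01 in_S min_Ph
    proof eventually_elim
      case (elim h)
      \<comment> \<open>The ball must lie in the neighbourhood on which \<open>\<beta>\<^sub>h\<close> is minimal and in the one on which
        \<open>\<Lambda>\<close> is defined and continuous; the latter is centred at the limit, whence \<open>\<eta> / 2\<close>.\<close>
      obtain e where e: "e > 0" and min: "\<And>z. z \<in> param_dom \<Theta> V \<Longrightarrow> dist z (b h, g h) < e \<Longrightarrow>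
          R_obj \<rho>1 \<sigma> (contam P s h) (b h) (V (g h)) \<le> (case z of (b, g) \<Rightarrow> R_obj \<rho>1 \<sigma> (contam P s h) b (V g))"
        using elim(4) unfolding local_min_on_def b_def g_def prod.case by blast
      have near: "((b', g h), t h) \<in> S \<inter> (U \<inter> ball ?z0 \<delta>)" if "b' \<in> ball (b h) (min e (\<eta> / 2))" for b'
      proof -
        have "dist ((b', g h), t h) ?z0 \<le> dist ((b', g h), t h) (?w h) + dist (?w h) ?z0"
          by (rule dist_triangle)
        also have "\<dots> < \<eta> / 2 + \<eta> / 2"
          using that elim(1) by (intro add_strict_mono) (auto simp: dist_Pair_Pair dist_commute)
        finally have "((b', g h), t h) \<in> ball ?z0 \<eta>" by (simp add: dist_commute)
        then show ?thesis using \<eta>(2) S_slice[OF elim(3)] by blast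
      qed
      show ?case
      proof (rule contaminated_risk_stationary[OF P, where e = "min e (\<eta> / 2)"])
        show "V (g h) \<in> PDS" "0 < t h" using pds[OF elim(3)] by auto
        show "0 < min e (\<eta> / 2)" using e \<eta>(1) by simp
        show "0 \<le> h" "h \<le> 1" using elim(2) by auto
        show "integrable P (\<lambda>z. Psi_beta u1 V z (b', g h) (t h))"
          if "b' \<in> ball (b h) (min e (\<eta> / 2))" for b'
          using near[OF that] by (intro int) auto
        show "continuous_on (ball (b h) (min e (\<eta> / 2))) (\<lambda>b'. ?L b' (g h) (t h))"
          by (intro continuous_at_imp_continuous_on ballI cont) (use near in auto)
        show "(\<integral>z. \<rho>1 (mahal (V (g h)) (b h) z / t h) \<partial>contam P s h)
            \<le> (\<integral>z. \<rho>1 (mahal (V (g h)) b' z / t h) \<partial>contam P s h)"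
          if "b' \<in> ball (b h) (min e (\<eta> / 2))" for b'
          using min[of "(b', g h)"] that S_slice[OF elim(3), of b']
          by (simp add: S_def R_obj_def t_def dist_Pair_Pair dist_commute)
      qed
    qed
  qed

  \<comment> \<open>The difference quotient \<open>x\<close> solves \<open>D x = y\<close> up to an error of smaller order than \<open>x\<close>.\<close>
  define x where "x = (\<lambda>h. (b h - bP) /\<^sub>R h)"
  define y where "y = (\<lambda>h. ?L (b h) (g h) (t h) /\<^sub>R h)"
  have "(x \<longlongrightarrow> matrix_inv D *v (- Psi_beta u1 V s (bP, gP) tP)) (at_right 0)"
  proof (rule perturbed_linear_equation_tendsto[OF D(2)])
    show "\<forall>\<^sub>F h in at_right 0. D *v x h + (y h - D *v x h) = y h" by simp
  next
    fix \<epsilon> :: real assume "\<epsilon> > 0"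
    from C1[OF this] obtain \<delta> where \<delta>: "\<delta> > 0"
      and lin: "\<And>b g t. ((b, g), t) \<in> S \<inter> ball ?z0 \<delta> \<Longrightarrow>
        norm (?L b g t - ?L bP g t - D *v (b - bP)) \<le> \<epsilon> * norm (b - bP)"
      by blast
    show "\<forall>\<^sub>F h in at_right 0. norm (y h - D *v x h) \<le> \<epsilon> * norm (x h)"
      using tendstoD[OF conv' \<delta>] in_S h01
    proof eventually_elim
      case (elim h)
      have zero: "?L bP (g h) (t h) = 0"
        using Lambda_beta_point_of_symmetry[OF P symm u1(2)] pds(3)[OF elim(2)]
        unfolding bP_def by (metis less_irrefl)
      have "norm (?L (b h) (g h) (t h) - D *v (b h - bP)) \<le> \<epsilon> * norm (b h - bP)"
        using lin[of "b h" "g h" "t h"] elim by (simp add: zero dist_commute)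
      moreover have "y h - D *v x h = (?L (b h) (g h) (t h) - D *v (b h - bP)) /\<^sub>R h"
        unfolding x_def y_def matrix_vector_mult_scaleR by (rule scaleR_diff_right[symmetric])
      then have "norm (y h - D *v x h) = inverse h * norm (?L (b h) (g h) (t h) - D *v (b h - bP))"
        using elim(3) by simp
      moreover have "norm (x h) = inverse h * norm (b h - bP)"
        using elim(3) by (simp add: x_def)
      ultimately show ?case
        using elim(3) by simp
    qed
  next
    have Psi: "((\<lambda>h. Psi_beta u1 V s (b h, g h) (t h)) \<longlongrightarrow> Psi_beta u1 V s (bP, gP) tP) (at_right 0)"
    proof (cases s)
      case (Pair y X)
      have in\<Theta>: "\<forall>\<^sub>F h in at_right 0. g h \<in> \<Theta>" using in_S by eventually_elim (rule pds(2))
      show ?thesis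
        unfolding Pair
      proof (rule tendsto_Psi_beta[OF _ _ t b])
        show "isCont u1 (mahal (V gP) bP (y, X) / tP)"
          using u1(2) by (simp add: continuous_on_eq_continuous_at)
        show "tP \<noteq> 0" using pds(3)[OF S0] by simp
        show "((\<lambda>h. V (g h)) \<longlongrightarrow> V gP) (at_right 0)"
          using continuous_on_tendsto_compose[OF V(3) g pds(2)[OF S0] in\<Theta>] .
        show "\<forall>\<^sub>F h in at_right 0. invertible (V (g h))"
          using in_S by eventually_elim (rule PDS_invertible, rule pds(1))
        show "invertible (V gP)" by (rule PDS_invertible, rule pds(1)[OF S0])
      qed
    qed
    have "((\<lambda>h. (- 1 / (1 - h)) *\<^sub>R Psi_beta u1 V s (b h, g h) (t h)) \<longlongrightarrow>
        (- 1 / (1 - 0)) *\<^sub>R Psi_beta u1 V s (bP, gP) tP) (at_right 0)"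
      by (intro tendsto_intros Psi) simp
    moreover have "\<forall>\<^sub>F h in at_right 0. (- 1 / (1 - h)) *\<^sub>R Psi_beta u1 V s (b h, g h) (t h) = y h"
      using stationary h01
    proof eventually_elim
      case (elim h)
      have "(1 - h) *\<^sub>R ?L (b h) (g h) (t h) = - (h *\<^sub>R Psi_beta u1 V s (b h, g h) (t h))"
        using elim(1) by (simp add: eq_neg_iff_add_eq_0)
      then have "(1 / (h * (1 - h))) *\<^sub>R (1 - h) *\<^sub>R ?L (b h) (g h) (t h) =
          (1 / (h * (1 - h))) *\<^sub>R (- (h *\<^sub>R Psi_beta u1 V s (b h, g h) (t h)))"
        by simp
      then show ?case using elim(2) by (simp add: y_def inverse_eq_divide)
    qed
    ultimately show "(y \<longlongrightarrow> - Psi_beta u1 V s (bP, gP) tP) (at_right 0)"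
      by (auto elim: Lim_transform_eventually)
  qed
  then show ?thesis
    unfolding has_influence_function_def by (simp add: x_def b_def defs vec.neg)
qed

end
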